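(* Let $\mathfrak E$ be a tropical bundle of rank $r$ on a complete fan $\Delta\subseteq N_{\mathbb R}$ with piecewise linear map $\Phi:|\Delta|\to\operatorname{Berg}(\mathrm M)$, and suppose that $\mathfrak E$ has trivial equivariant Chern class with global Chern roots $\boldsymbol u=\{u_1,\dots,u_r\}$ (a multiset). Then the function $F=F_{\mathfrak E}:\operatorname{Sw}(\boldsymbol u)\to\operatorname{Fl}(\mathrm M)$ induced by $\mathfrak E$ is a flag decoration of the sweep polytope $Z(\boldsymbol u)$.
   Context: **Bergman fan.** $N$ is a lattice with dual $M$. Let $\mathrm M$ be a loopless matroid of rank $r$ on $\mathrm E$, with closure $\operatorname{cl}_{\mathrm M}$. $\operatorname{Berg}(\mathrm M)\subset\mathbb R^{\mathrm E}$ consists of the cones $\operatorname{cone}(e_{F^1},\dots,e_{F^{k-1}})+\mathbb R\boldsymbol 1$ for flags of flats $\varnothing\subset F^1\subset\dots\subset F^k=\mathrm E$ (strict inclusions), where $e_S=\sum_{s\in S}e_s$; $\operatorname{Fl}(\mathrm M)$ is the set of these flags, partially ordered by refinement. For a basis $B$ of $\mathrm M$, $\phi_B:\mathbb R^B\cong\mathbb R^r\to\operatorname{Berg}(\mathrm M)$ is given by $\phi_B(w)_i=w_i$ if $i\in B$ and $\phi_B(w)_i=\min\{w_j\mid j\in C_i(B)\setminus i\}$ otherwise, $C_i(B)$ being the fundamental circuit of $i$ with respect to $B$. It is a PL isomorphism onto its image with inverse the coordinate projection $\pi_B$. **Tropical bundles.** Fans are rational polyhedral, possibly with nonzero lineality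 space. A tropical bundle $\mathfrak E$ of rank $r$ on $\Delta$ is given by a map $\Phi:|\Delta|\to\operatorname{Berg}(\mathrm M)$ (its PL map) such that for each $\delta\in\Delta$ there exist an (ordered) basis $B_\delta$ of $\mathrm M$ and an integral linear map $T_\delta:\operatorname{span}|\delta|\to\mathbb R^r$ with $\Phi|_\delta=\phi_{B_\delta}\circ T_\delta$. Its $i$-th equivariant Chern class is given on each $\delta$ by $\epsilon_i\circ\pi_{B_\delta}\circ\Phi|_\delta$ ($\epsilon_i$ elementary symmetric). $\mathfrak E$ has trivial equivariant Chern class if $1+c_1^T+\dots+c_r^T$ is globally polynomial; for complete $\Delta$ this is equivalent to the existence of a global multiset of Chern roots $\boldsymbol u=\{u_1,\dots,u_r\}\subset M$, i.e., with $T=(\langle u_1,\cdot\rangle,\dots,\langle u_r,\cdot\rangle):N_{\mathbb R}\to\mathbb R^r$, for every $\delta\in\Delta$ there is an ordered basis $B_\delta$ of $\mathrm M$ with $\Phi|_\delta=\phi_{B_\delta}\circ T|_\delta$. **Sweeps.** For $x\in N_{\mathbb R}$ let $\lambda_1>\dots>\lambda_k$ be all the distinct values of $\langle u_j,x\rangle$, $j\in[r]$. The sweep $\mathcal W_x$ is the flag $\varnothing\subset W^1\subset\dots\subset W^k=[r]$ with $W^i=\{j\in[r]\mid\langle u_j,x\rangle\ge\lambda_i\}$. $\operatorname{Sw}(\boldsymbol u)$ is the set of sweeps, partially ordered by refinement. The sweep polytope is $Z(\boldsymbol u)=\sum_{i<j}[u_i,u_j]$; its normal fan is the sweep fan $\Sigma(\boldsymbol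 u)$, whose cones $C(\mathcal W)$ are indexed by sweeps, with $\operatorname{relint}C(\mathcal W)=\{x\mid\mathcal W_x=\mathcal W\}$. **Flag decorations of sweep polytopes.** A flag decoration of $Z(\boldsymbol u)$ is a map of posets $F:\operatorname{Sw}(\boldsymbol u)\to\operatorname{Fl}(\mathrm M)$ such that for any sweep $\mathcal W:\varnothing\subset W^1\subset\dots\subset W^k=[r]$, the flag $F(\mathcal W):\varnothing\subset F(\mathcal W)^1\subset\dots\subset F(\mathcal W)^k=\mathrm E$ has the same rank shape: $\operatorname{rk}_{\mathrm M}F(\mathcal W)^i=|W^i|$ for every $1\le i\le k$. **Induced function.** For a sweep $\mathcal W$, pick $x\in\operatorname{relint}C(\mathcal W)$, a cone $\delta\in\Delta$ containing $x$, and an ordered basis $B_\delta=(b_1,\dots,b_r)$ with $\Phi|_\delta=\phi_{B_\delta}\circ T|_\delta$. The flag of flats determined by $\Phi(x)$ (the flag whose Bergman cone contains $\Phi(x)$ in its relative interior) has $i$-th flat $\operatorname{cl}_{\mathrm M}\{b_j\mid j\in W^i\}$. This flag is constant for $x\in\operatorname{relint}C(\mathcal W)$, and it is denoted $F(\mathcal W)$. *)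

theory Defs
  imports "HOL-Analysis.Analysis"
begin

text \<open>
  Conventions. \<open>N_R\<close> is \<^term>\<open>span N\<close>, for a lattice \<open>N\<close> inside some Euclidean space; the inner
  product of that space serves as the pairing, so that \<open>M\<close> becomes a subset of \<^term>\<open>span N\<close>
  and \<open>\<langle>u, x\<rangle>\<close> is \<^term>\<open>u \<bullet> x\<close>.  The ground set of a matroid is a whole finite type \<open>'e\<close>, and
  \<open>\<I>\<close> is its family of independent sets.  Elements of \<open>R^r\<close> are functions \<^typ>\<open>nat \<Rightarrow> real\<close> of which
  only the values on \<open>[r] = {1..r}\<close> matter; likewise for \<open>r\<close>-tuples of vectors and for
  ordered bases.
\<close>

section \<open>Lattices and fans\<close>

definition is_lattice :: "'v::euclidean_space set \<Rightarrow> bool" where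
  "is_lattice N \<longleftrightarrow> (\<exists>B. independent B \<and> N = {\<Sum>b\<in>B. of_int (c b) *\<^sub>R b | c :: 'v \<Rightarrow> int. True})"

definition dual_lattice :: "'v::euclidean_space set \<Rightarrow> 'v set" where
  "dual_lattice N = {u \<in> span N. \<forall>x\<in>N. u \<bullet> x \<in> \<int>}"

definition rational_cone :: "'v::euclidean_space set \<Rightarrow> 'v set \<Rightarrow> bool" where
  "rational_cone N \<sigma> \<longleftrightarrow> (\<exists>S. finite S \<and> S \<subseteq> N \<and> \<sigma> = convex_cone hull S)"

text \<open>Cones need not be pointed. The empty set is a face in the sense of \<^const>\<open>face_of\<close>, but it
  is not a cone.\<close>

definition is_fan :: "'v::euclidean_space set \<Rightarrow> 'v set set \<Rightarrow> bool" where
  "is_fan N \<Delta> \<longleftrightarrow> finite \<Delta> \<and> (\<forall>\<sigma>\<in>\<Delta>. rational_cone N \<sigma>)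
     \<and> (\<forall>\<sigma>\<in>\<Delta>. \<forall>\<tau>. \<tau> face_of \<sigma> \<and> \<tau> \<noteq> {} \<longrightarrow> \<tau> \<in> \<Delta>)
     \<and> (\<forall>\<sigma>\<in>\<Delta>. \<forall>\<tau>\<in>\<Delta>. \<sigma> \<inter> \<tau> face_of \<sigma> \<and> \<sigma> \<inter> \<tau> face_of \<tau>)"

definition complete_fan :: "'v::euclidean_space set \<Rightarrow> 'v set set \<Rightarrow> bool" where
  "complete_fan N \<Delta> \<longleftrightarrow> is_fan N \<Delta> \<and> \<Union>\<Delta> = span N"

section \<open>Matroids\<close>

definition matroid :: "'e::finite set set \<Rightarrow> bool" where
  "matroid \<I> \<longleftrightarrow> {} \<in> \<I> \<and> (\<forall>A\<in>\<I>. \<forall>B. B \<subseteq> A \<longrightarrow> B \<in> \<I>)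
     \<and> (\<forall>A\<in>\<I>. \<forall>B\<in>\<I>. card A < card B \<longrightarrow> (\<exists>x\<in>B - A. insert x A \<in> \<I>))"

definition loopless :: "'e::finite set set \<Rightarrow> bool" where
  "loopless \<I> \<longleftrightarrow> (\<forall>i. {i} \<in> \<I>)"

definition matroid_rank :: "'e::finite set set \<Rightarrow> 'e set \<Rightarrow> nat" where
  "matroid_rank \<I> S = Max {card A | A. A \<in> \<I> \<and> A \<subseteq> S}"

definition matroid_closure :: "'e::finite set set \<Rightarrow> 'e set \<Rightarrow> 'e set" where
  "matroid_closure \<I> S = {x. matroid_rank \<I> (insert x S) = matroid_rank \<I> S}"

definition is_flat :: "'e::finite set set \<Rightarrow> 'e set \<Rightarrow> bool" where
  "is_flat \<I> F \<longleftrightarrow> matroid_closure \<I> F = F"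

definition is_basis :: "'e::finite set set \<Rightarrow> 'e set \<Rightarrow> bool" where
  "is_basis \<I> B \<longleftrightarrow> B \<in> \<I> \<and> (\<forall>A\<in>\<I>. B \<subseteq> A \<longrightarrow> A = B)"

definition is_circuit :: "'e::finite set set \<Rightarrow> 'e set \<Rightarrow> bool" where
  "is_circuit \<I> C \<longleftrightarrow> C \<notin> \<I> \<and> (\<forall>A. A \<subset> C \<longrightarrow> A \<in> \<I>)"

definition fundamental_circuit :: "'e::finite set set \<Rightarrow> 'e set \<Rightarrow> 'e \<Rightarrow> 'e set" where
  "fundamental_circuit \<I> B i = (THE C. is_circuit \<I> C \<and> C \<subseteq> insert i B)"

definition ordered_basis :: "'e::finite set set \<Rightarrow> nat \<Rightarrow> (nat \<Rightarrow> 'e) \<Rightarrow> bool" where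
  "ordered_basis \<I> r b \<longleftrightarrow> inj_on b {1..r} \<and> is_basis \<I> (b ` {1..r})"

section \<open>Flags and the Bergman fan\<close>

text \<open>A flag \<open>\<emptyset> \<subset> F\<^sup>1 \<subset> \<dots> \<subset> F\<^sup>k\<close> is the list \<open>[F\<^sup>1, \<dots>, F\<^sup>k]\<close>, so \<open>F\<^sup>i\<close> has list index \<open>i - 1\<close>.
  The relation below, used both for sweeps and for flags of flats, says that the second flag
  refines the first.\<close>

definition refined_by :: "'a set list \<Rightarrow> 'a set list \<Rightarrow> bool" where
  "refined_by \<F> \<G> \<longleftrightarrow> set \<F> \<subseteq> set \<G>"

definition flags_of_flats :: "'e::finite set set \<Rightarrow> 'e set list set" where
  "flags_of_flats \<I> = {\<F>. \<F> \<noteq> [] \<and> sorted_wrt (\<subset>) ({} # \<F>) \<and> last \<F> = UNIV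
     \<and> (\<forall>F\<in>set \<F>. is_flat \<I> F)}"

definition e_vec :: "'e::finite set \<Rightarrow> real ^ 'e" where
  "e_vec S = (\<Sum>s\<in>S. axis s 1)"

definition bergman_cone :: "'e::finite set list \<Rightarrow> (real ^ 'e) set" where
  "bergman_cone \<F> = {x + y | x y. x \<in> convex_cone hull (e_vec ` set (butlast \<F>)) \<and> y \<in> span {e_vec UNIV}}"

definition Berg :: "'e::finite set set \<Rightarrow> (real ^ 'e) set set" where
  "Berg \<I> = bergman_cone ` flags_of_flats \<I>"

text \<open>\<open>\<phi>\<^sub>B\<close> and \<open>\<pi>\<^sub>B\<close>, with \<open>R\<^sup>B\<close> identified with \<open>R\<^sup>r\<close> by the ordering \<open>b\<close> of \<open>B\<close>.\<close>

definition basis_phi :: "'e::finite set set \<Rightarrow> nat \<Rightarrow> (nat \<Rightarrow> 'e) \<Rightarrow> (nat \<Rightarrow> real) \<Rightarrow> real ^ 'e" where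
  "basis_phi \<I> r b w =
     (let B = b ` {1..r}; w' = (\<lambda>i. w (inv_into {1..r} b i))
      in \<chi> i. if i \<in> B then w' i else Min (w' ` (fundamental_circuit \<I> B i - {i})))"

definition basis_pi :: "(nat \<Rightarrow> 'e::finite) \<Rightarrow> real ^ 'e \<Rightarrow> nat \<Rightarrow> real" where
  "basis_pi b v = (\<lambda>j. v $ b j)"

section \<open>Tropical bundles\<close>

text \<open>An integral linear map from the span of \<open>\<delta>\<close> to \<open>R\<^sup>r\<close>, given by its \<open>r\<close> components. Each
  component is taken as the restriction of a linear form on the ambient space.\<close>

definition integral_linear_map ::
    "'v::euclidean_space set \<Rightarrow> nat \<Rightarrow> 'v set \<Rightarrow> ('v \<Rightarrow> nat \<Rightarrow> real) \<Rightarrow> bool" where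
  "integral_linear_map N r \<delta> T \<longleftrightarrow>
     (\<forall>j\<in>{1..r}. linear (\<lambda>x. T x j) \<and> (\<forall>x \<in> N \<inter> span \<delta>. T x j \<in> \<int>))"

definition local_trivialization ::
    "'v::euclidean_space set \<Rightarrow> 'e::finite set set \<Rightarrow> nat \<Rightarrow> ('v \<Rightarrow> real ^ 'e) \<Rightarrow> 'v set
      \<Rightarrow> (nat \<Rightarrow> 'e) \<Rightarrow> ('v \<Rightarrow> nat \<Rightarrow> real) \<Rightarrow> bool" where
  "local_trivialization N \<I> r \<Phi> \<delta> b T \<longleftrightarrow> ordered_basis \<I> r b \<and> integral_linear_map N r \<delta> T
     \<and> (\<forall>x\<in>\<delta>. \<Phi> x = basis_phi \<I> r b (T x))"

definition tropical_bundle ::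
    "'v::euclidean_space set \<Rightarrow> 'v set set \<Rightarrow> 'e::finite set set \<Rightarrow> nat \<Rightarrow> ('v \<Rightarrow> real ^ 'e) \<Rightarrow> bool" where
  "tropical_bundle N \<Delta> \<I> r \<Phi> \<longleftrightarrow> matroid \<I> \<and> loopless \<I> \<and> matroid_rank \<I> UNIV = r
     \<and> \<Phi> ` \<Union>\<Delta> \<subseteq> \<Union>(Berg \<I>)
     \<and> (\<forall>\<delta>\<in>\<Delta>. \<exists>b T. local_trivialization N \<I> r \<Phi> \<delta> b T)"

definition elem_sym :: "nat \<Rightarrow> nat \<Rightarrow> (nat \<Rightarrow> real) \<Rightarrow> real" where
  "elem_sym r i w = (\<Sum>S | S \<subseteq> {1..r} \<and> card S = i. \<Prod>j\<in>S. w j)"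

text \<open>The value at \<open>x\<close> depends neither on the cone containing \<open>x\<close> nor on the basis.\<close>

definition chern_class ::
    "'v::euclidean_space set \<Rightarrow> 'v set set \<Rightarrow> 'e::finite set set \<Rightarrow> nat \<Rightarrow> ('v \<Rightarrow> real ^ 'e)
      \<Rightarrow> nat \<Rightarrow> 'v \<Rightarrow> real" where
  "chern_class N \<Delta> \<I> r \<Phi> i x = (THE c. \<forall>\<delta>\<in>\<Delta>. x \<in> \<delta> \<longrightarrow>
     (\<forall>b T. local_trivialization N \<I> r \<Phi> \<delta> b T \<longrightarrow> c = elem_sym r i (basis_pi b (\<Phi> x))))"

definition trivial_chern_class ::
    "'v::euclidean_space set \<Rightarrow> 'v set set \<Rightarrow> 'e::finite set set \<Rightarrow> nat \<Rightarrow> ('v \<Rightarrow> real ^ 'e) \<Rightarrow> bool" where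
  "trivial_chern_class N \<Delta> \<I> r \<Phi> \<longleftrightarrow> (\<exists>p. real_polynomial_function p \<and>
     (\<forall>x\<in>\<Union>\<Delta>. 1 + (\<Sum>i=1..r. chern_class N \<Delta> \<I> r \<Phi> i x) = p x))"

text \<open>The multiset of Chern roots is given through an enumeration \<open>u 1, \<dots>, u r\<close>.\<close>

definition global_chern_roots ::
    "'v::euclidean_space set \<Rightarrow> 'v set set \<Rightarrow> 'e::finite set set \<Rightarrow> nat \<Rightarrow> ('v \<Rightarrow> real ^ 'e)
      \<Rightarrow> (nat \<Rightarrow> 'v) \<Rightarrow> bool" where
  "global_chern_roots N \<Delta> \<I> r \<Phi> u \<longleftrightarrow> (\<forall>j\<in>{1..r}. u j \<in> dual_lattice N)
     \<and> (\<forall>\<delta>\<in>\<Delta>. \<exists>b. ordered_basis \<I> r b \<and> (\<forall>x\<in>\<delta>. \<Phi> x = basis_phi \<I> r b (\<lambda>j. u j \<bullet> x)))"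

section \<open>Sweeps and the sweep polytope\<close>

definition sweep :: "nat \<Rightarrow> (nat \<Rightarrow> 'v::euclidean_space) \<Rightarrow> 'v \<Rightarrow> nat set list" where
  "sweep r u x = map (\<lambda>l. {j\<in>{1..r}. u j \<bullet> x \<ge> l})
     (rev (sorted_list_of_set ((\<lambda>j. u j \<bullet> x) ` {1..r})))"

definition sweeps :: "'v::euclidean_space set \<Rightarrow> nat \<Rightarrow> (nat \<Rightarrow> 'v) \<Rightarrow> nat set list set" where
  "sweeps N r u = sweep r u ` span N"

text \<open>A Minkowski sum; for \<open>r = 1\<close> it is the origin.\<close>

definition sweep_polytope :: "nat \<Rightarrow> (nat \<Rightarrow> 'v::euclidean_space) \<Rightarrow> 'v set" where
  "sweep_polytope r u = (\<Sum>(i, j) \<in> {(i, j). 1 \<le> i \<and> i < j \<and> j \<le> r}. closed_segment (u i) (u j))"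

text \<open>Normal cones are outer: they consist of the functionals maximized on the given face.\<close>

definition normal_cone :: "'v::euclidean_space set \<Rightarrow> 'v set \<Rightarrow> 'v set \<Rightarrow> 'v set" where
  "normal_cone N P F = {x \<in> span N. \<forall>p\<in>F. \<forall>q\<in>P. q \<bullet> x \<le> p \<bullet> x}"

definition normal_fan :: "'v::euclidean_space set \<Rightarrow> 'v set \<Rightarrow> 'v set set" where
  "normal_fan N P = {normal_cone N P F | F. F face_of P \<and> F \<noteq> {}}"

definition sweep_fan :: "'v::euclidean_space set \<Rightarrow> nat \<Rightarrow> (nat \<Rightarrow> 'v) \<Rightarrow> 'v set set" where
  "sweep_fan N r u = normal_fan N (sweep_polytope r u)"

text \<open>The cone is unique because the closed convex cones of the sweep fan are the closures of their
  relative interiors.\<close>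

definition sweep_cone :: "'v::euclidean_space set \<Rightarrow> nat \<Rightarrow> (nat \<Rightarrow> 'v) \<Rightarrow> nat set list \<Rightarrow> 'v set" where
  "sweep_cone N r u W = (THE C. C \<in> sweep_fan N r u \<and> rel_interior C = {x \<in> span N. sweep r u x = W})"

section \<open>Flag decorations and the induced function\<close>

definition flag_decoration ::
    "'v::euclidean_space set \<Rightarrow> 'e::finite set set \<Rightarrow> nat \<Rightarrow> (nat \<Rightarrow> 'v)
      \<Rightarrow> (nat set list \<Rightarrow> 'e set list) \<Rightarrow> bool" where
  "flag_decoration N \<I> r u F \<longleftrightarrow>
     F \<in> sweeps N r u \<rightarrow> flags_of_flats \<I>
     \<and> monotone_on (sweeps N r u) refined_by refined_by F
     \<and> (\<forall>W \<in> sweeps N r u. length (F W) = length W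
          \<and> (\<forall>i < length W. matroid_rank \<I> (F W ! i) = card (W ! i)))"

definition flag_at :: "'e::finite set set \<Rightarrow> real ^ 'e \<Rightarrow> 'e set list" where
  "flag_at \<I> v = (THE \<F>. \<F> \<in> flags_of_flats \<I> \<and> v \<in> rel_interior (bergman_cone \<F>))"

text \<open>The constant value of the flag determined by \<open>\<Phi> x\<close>, for \<open>x\<close> in the relative interior of the
  cone of \<open>W\<close>.\<close>

definition induced_decoration ::
    "'v::euclidean_space set \<Rightarrow> 'e::finite set set \<Rightarrow> nat \<Rightarrow> (nat \<Rightarrow> 'v) \<Rightarrow> ('v \<Rightarrow> real ^ 'e)
      \<Rightarrow> nat set list \<Rightarrow> 'e set list" where
  "induced_decoration N \<I> r u \<Phi> W =
     (THE \<F>. \<forall>x \<in> rel_interior (sweep_cone N r u W). flag_at \<I> (\<Phi> x) = \<F>)"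

end

(* Both the cones of the sweep fan and the cones of the Bergman fan are order cones: they consist of
   the y for which a weak order on finitely many linear forms, namely the one given by a fixed point
   x, is preserved, and the relative interior consists of the y inducing exactly the same order.
   Hence the flag of a point v of the Bergman fan is the list of superlevel sets of its coordinates.
   For v = phi_B(w) the superlevel set at level l is the closure of {b_j | w_j >= l}, because i lies
   in the closure of a subset A of B iff its fundamental circuit is contained in A + i; such closures
   have the right rank.

   The points with a given sweep form a convex set covered by the finitely many closed cones of the
   fan, and on each of these the flag depends only on the sweep; so the flag is locally constant,
   hence constant. If the sweep of y refines that of x, the points of the segment from x to y other
   than x have the sweep of y, and those close to x share a cone with x, where monotonicity is
   evident. *)
theory Submission
  imports Defs
begin

section \<open>Order cones\<close>

text \<open>\<open>S\<close> is the ambient subspace and \<open>a\<close> the family of linear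
  forms. The condition applies to both orders of a pair, so forms that agree at \<open>x\<close>
  must agree at \<open>y\<close> as well.\<close>

definition order_cone :: "'v::euclidean_space set \<Rightarrow> 'i set \<Rightarrow> ('i \<Rightarrow> 'v) \<Rightarrow> 'v \<Rightarrow> 'v set" where
  "order_cone S I a x = {y\<in>S. \<forall>i\<in>I. \<forall>j\<in>I. a j \<bullet> x \<le> a i \<bullet> x \<longrightarrow> a j \<bullet> y \<le> a i \<bullet> y}"

lemma convex_order_cone: "subspace S \<Longrightarrow> convex (order_cone S I a x)"
  by (auto simp: order_cone_def convex_def subspace_def inner_add_right add_mono mult_left_mono)

text \<open>The ties at \<open>x\<close> cut out a subspace \<open>L\<close> containing the affine
  hull, and the strict inequalities at \<open>x\<close> an open set \<open>T\<close> with
  \<open>T \<inter> L\<close> inside the cone; so points of the cone in \<open>T\<close> are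
  relatively interior. Conversely, the segment from \<open>x\<close> to a relatively interior
  \<open>y\<close> can be prolonged beyond \<open>y\<close>, which forces the strict inequalities at
  \<open>y\<close>.\<close>

lemma rel_interior_order_cone:
  fixes S :: "'v::euclidean_space set"
  assumes S: "subspace S" and I: "finite I" and x: "x \<in> S"
  shows "rel_interior (order_cone S I a x) =
    {y\<in>S. \<forall>i\<in>I. \<forall>j\<in>I. a j \<bullet> x \<le> a i \<bullet> x \<longleftrightarrow> a j \<bullet> y \<le> a i \<bullet> y}" (is "_ = ?U")
proof -
  let ?C = "order_cone S I a x"
  have xC: "x \<in> ?C"
    using x by (simp add: order_cone_def)
  define L where "L = {y\<in>S. \<forall>i\<in>I. \<forall>j\<in>I. a j \<bullet> x = a i \<bullet> x \<longrightarrow> (a j - a i) \<bullet> y = 0}"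
  define T where "T = (\<Inter>(i, j) \<in> {(i, j) \<in> I \<times> I. a j \<bullet> x < a i \<bullet> x}. {y. a j \<bullet> y < a i \<bullet> y})"
  have "subspace L"
    using S by (simp add: L_def subspace_def inner_add_right)
  moreover have "?C \<subseteq> L"
    by (auto simp: order_cone_def L_def inner_diff_left intro!: antisym)
  ultimately have aff: "affine hull ?C \<subseteq> L"
    by (simp add: hull_minimal subspace_imp_affine)
  have "finite {(i, j) \<in> I \<times> I. a j \<bullet> x < a i \<bullet> x}"
    by (rule finite_subset[of _ "I \<times> I"]) (use I in auto)
  then have "open T"
    unfolding T_def by (intro open_INT) (auto intro!: open_Collect_less continuous_intros)
  have sub: "T \<inter> L \<subseteq> ?C"
  proof
    fix y assume y: "y \<in> T \<inter> L"
    have "a j \<bullet> y \<le> a i \<bullet> y" if "i \<in> I" "j \<in> I" "a j \<bullet> x \<le> a i \<bullet> x" for i j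
    proof (cases "a j \<bullet> x = a i \<bullet> x")
      case True
      then have "(a j - a i) \<bullet> y = 0"
        using that y by (simp add: L_def)
      then show ?thesis
        by (simp add: inner_diff_left)
    next
      case False
      then show ?thesis
        using that y by (auto simp: T_def intro: less_imp_le)
    qed
    then show "y \<in> ?C"
      using y by (simp add: L_def order_cone_def)
  qed
  show ?thesis
  proof (intro equalityI subsetI)
    fix y assume y: "y \<in> ?U"
    then have "y \<in> T" "y \<in> ?C"
      by (auto simp: T_def order_cone_def simp flip: not_le)
    then show "y \<in> rel_interior ?C"
      using \<open>open T\<close> aff sub unfolding mem_rel_interior by blast
  next
    fix y assume y: "y \<in> rel_interior ?C"
    then have yC: "y \<in> ?C"
      using rel_interior_subset by blast
    obtain e :: real where e: "e > 1" "(1 - e) *\<^sub>R x + e *\<^sub>R y \<in> ?C"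
      using y xC convex_rel_interior_iff[OF convex_order_cone[OF S]] by blast
    have "a j \<bullet> y < a i \<bullet> y" if "i \<in> I" "j \<in> I" "a j \<bullet> x < a i \<bullet> x" for i j
    proof -
      have "(1 - e) * (a j \<bullet> x) + e * (a j \<bullet> y) \<le> (1 - e) * (a i \<bullet> x) + e * (a i \<bullet> y)"
        using e(2) that by (simp add: order_cone_def inner_add_right)
      \<comment> \<open>The coefficient of \<open>x\<close> at the prolonged point is negative, so
        strictness at \<open>x\<close> passes to \<open>y\<close>.\<close>
      moreover have "(e - 1) * (a j \<bullet> x) < (e - 1) * (a i \<bullet> x)"
        using that(3) e(1) by simp
      ultimately have "e * (a j \<bullet> y) < e * (a i \<bullet> y)"
        unfolding left_diff_distrib by linarith
      then show ?thesis
        using e(1) by simp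
    qed
    then show "y \<in> ?U"
      using yC by (auto simp: order_cone_def simp flip: not_less)
  qed
qed

section \<open>Superlevel flags\<close>

text \<open>The common form of sweeps (\<open>A = {1..r}\<close>) and of flags of Bergman points
  (\<open>A = UNIV\<close>). Levels are listed in decreasing order so that the sets
  increase.\<close>

definition superlevel_flag :: "'i set \<Rightarrow> ('i \<Rightarrow> real) \<Rightarrow> 'i set list" where
  "superlevel_flag A f = map (\<lambda>l. {j\<in>A. f j \<ge> l}) (rev (sorted_list_of_set (f ` A)))"

lemma sweep_eq_superlevel_flag: "sweep r u x = superlevel_flag {1..r} (\<lambda>j. u j \<bullet> x)"
  by (simp add: sweep_def superlevel_flag_def)

lemma set_superlevel_flag:
  "finite A \<Longrightarrow> set (superlevel_flag A f) = (\<lambda>i. {j\<in>A. f i \<le> f j}) ` A"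
  by (auto simp: superlevel_flag_def)

lemma sorted_superlevel_flag:
  assumes "finite A"
  shows "sorted_wrt (\<subset>) ({} # superlevel_flag A f)"
proof -
  have "sorted_wrt (\<subset>) (superlevel_flag A f)"
    unfolding superlevel_flag_def sorted_wrt_map sorted_wrt_rev
  proof (rule sorted_wrt_mono_rel[OF _ strict_sorted_list_of_set])
    fix l k assume "l \<in> set (sorted_list_of_set (f ` A))" "l < k"
    then show "{j \<in> A. k \<le> f j} \<subset> {j \<in> A. l \<le> f j}"
      using assms by force
  qed
  then show ?thesis
    using assms by (auto simp: set_superlevel_flag)
qed

text \<open>The head of a strict chain is its least member, hence determined by the set of members.
  Equality of flags can thus be checked on sets.\<close>

lemma sorted_psubset_unique:
  assumes "sorted_wrt (\<subset>) xs" "sorted_wrt (\<subset>) ys" "set xs = set ys"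
  shows "xs = ys"
  using assms
proof (induction xs arbitrary: ys)
  case Nil
  then show ?case by simp
next
  case (Cons x xs)
  obtain y zs where ys: "ys = y # zs"
    using Cons.prems(3) by (cases ys) auto
  have "x = y"
    using Cons.prems unfolding ys by (simp add: set_eq_iff) (metis psubset_eq psubset_trans)
  moreover have "set xs = set zs"
    using Cons.prems \<open>x = y\<close> unfolding ys
    by (simp) (metis insert_ident psubset_eq)
  ultimately show ?case
    using Cons ys by simp
qed

text \<open>The superlevel set at level \<open>f j\<close> belongs to the flag and contains
  \<open>j\<close>, so the flag determines the weak order of the values of \<open>f\<close>.\<close>

lemma le_iff_superlevel_flag:
  assumes "finite A" "i \<in> A" "j \<in> A"
  shows "f j \<le> f i \<longleftrightarrow> (\<forall>F\<in>set (superlevel_flag A f). j \<in> F \<longrightarrow> i \<in> F)"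
  using assms by (auto simp: set_superlevel_flag intro: order_trans)

lemma superlevel_flag_cong:
  assumes "finite A"
    and "\<And>i j. i \<in> A \<Longrightarrow> j \<in> A \<Longrightarrow> f j \<le> f i \<longleftrightarrow> g j \<le> g i"
  shows "superlevel_flag A f = superlevel_flag A g"
proof (rule sorted_psubset_unique)
  have "(\<lambda>i. {j\<in>A. f i \<le> f j}) ` A = (\<lambda>i. {j\<in>A. g i \<le> g j}) ` A"
    using assms(2) by (intro image_cong) auto
  then show "set (superlevel_flag A f) = set (superlevel_flag A g)"
    using assms(1) by (simp add: set_superlevel_flag)
qed (use sorted_superlevel_flag[OF assms(1)] in simp_all)

lemma superlevel_flag_eq_iff:
  assumes "finite A"
  shows "superlevel_flag A f = superlevel_flag A g \<longleftrightarrow>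
    (\<forall>i\<in>A. \<forall>j\<in>A. f j \<le> f i \<longleftrightarrow> g j \<le> g i)"
proof
  assume eq: "superlevel_flag A f = superlevel_flag A g"
  show "\<forall>i\<in>A. \<forall>j\<in>A. f j \<le> f i \<longleftrightarrow> g j \<le> g i"
    by (auto simp only: le_iff_superlevel_flag[OF assms] eq)
next
  assume "\<forall>i\<in>A. \<forall>j\<in>A. f j \<le> f i \<longleftrightarrow> g j \<le> g i"
  then show "superlevel_flag A f = superlevel_flag A g"
    by (intro superlevel_flag_cong assms) simp
qed

section \<open>The sweep fan\<close>

lemma rel_interior_sweep_order_cone:
  assumes "x \<in> span N"
  shows "rel_interior (order_cone (span N) {1..r} u x) = {y\<in>span N. sweep r u y = sweep r u x}"
  unfolding rel_interior_order_cone[OF subspace_span finite_atLeastAtMost assms]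
    sweep_eq_superlevel_flag superlevel_flag_eq_iff[OF finite_atLeastAtMost] by fastforce

lemma closed_normal_cone: "closed (normal_cone N P F)"
proof -
  have "normal_cone N P F = span N \<inter> (\<Inter>p\<in>F. \<Inter>q\<in>P. {x. q \<bullet> x \<le> p \<bullet> x})"
    by (auto simp: normal_cone_def)
  then show ?thesis
    by (auto intro!: closed_Int closed_INT closed_Collect_le continuous_intros closed_span)
qed

lemma convex_normal_cone: "convex (normal_cone N P F)"
proof -
  have "normal_cone N P F = span N \<inter> (\<Inter>p\<in>F. \<Inter>q\<in>P. {x. (q - p) \<bullet> x \<le> 0})"
    by (auto simp: normal_cone_def inner_diff_left)
  then show ?thesis
    by (auto intro!: convex_Int convex_INT convex_halfspace_le
        subspace_imp_convex[OF subspace_span])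
qed

text \<open>A closed convex set is the closure of its relative interior. This gives the uniqueness
  needed for the description defining \<open>sweep_cone\<close>.\<close>

lemma normal_cone_rel_interior_inject:
  assumes "rel_interior (normal_cone N P F) = rel_interior (normal_cone N P G)"
  shows "normal_cone N P F = normal_cone N P G"
  using assms by (metis closed_normal_cone closure_closed convex_closure_rel_interior convex_normal_cone)

section \<open>The sweep polytope as a Minkowski sum of segments\<close>

abbreviation index_pairs :: "nat \<Rightarrow> (nat \<times> nat) set" where
  "index_pairs r \<equiv> {(i, j). 1 \<le> i \<and> i < j \<and> j \<le> r}"

lemma finite_index_pairs: "finite (index_pairs r)"
  by (rule finite_subset[of _ "{1..r} \<times> {1..r}"]) auto

lemma sum_fun_upd:
  fixes s :: "'a \<Rightarrow> 'b::ab_group_add"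
  assumes "finite A" "a \<in> A"
  shows "sum (s(a := v)) A = sum s A - s a + v"
  using assms by (simp add: sum.remove)

lemma sweep_polytope_eq:
  "sweep_polytope r u =
    {sum s (index_pairs r) | s. \<forall>(i, j) \<in> index_pairs r. s (i, j) \<in> closed_segment (u i) (u j)}"
  unfolding sweep_polytope_def by (subst set_sum_alt[OF finite_index_pairs]) (auto simp: case_prod_unfold)

lemma convex_sweep_polytope: "convex (sweep_polytope r u)"
  unfolding sweep_polytope_def by (intro convex_set_sum) auto

text \<open>A linear form that is larger at \<open>b\<close> than at \<open>a\<close> loses a
  positive amount as soon as the weight of \<open>a\<close> is positive.\<close>

lemma closed_segment_max:
  fixes a b x :: "'v::euclidean_space"
  assumes "p \<in> closed_segment a b" "a \<bullet> x < b \<bullet> x" "b \<bullet> x \<le> p \<bullet> x"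
  shows "p = b"
proof -
  obtain t where t: "0 \<le> t" "t \<le> 1" "p = (1 - t) *\<^sub>R a + t *\<^sub>R b"
    using assms(1) by (auto simp: in_segment)
  have "b \<bullet> x \<le> b \<bullet> x - (1 - t) * (b \<bullet> x - a \<bullet> x)"
    using assms(3) by (simp add: t(3) inner_add_left algebra_simps)
  then have "(1 - t) * (b \<bullet> x - a \<bullet> x) \<le> 0"
    by simp
  then have "t = 1"
    using assms(2) t(2) by (simp add: mult_le_0_iff)
  then show ?thesis
    using t(3) by simp
qed

lemma closed_segment_inner_le:
  fixes a b x :: "'v::euclidean_space"
  assumes "p \<in> closed_segment a b" "a \<bullet> x \<le> c" "b \<bullet> x \<le> c"
  shows "p \<bullet> x \<le> c"
proof -
  have "closed_segment a b \<subseteq> {p. x \<bullet> p \<le> c}"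
    using assms by (intro closed_segment_subset convex_halfspace_le) (auto simp: inner_commute)
  then show ?thesis
    using assms(1) by (auto simp: inner_commute)
qed

text \<open>\<open>vertex k\<close> maximizes \<open>x\<close> and breaks every tie involving \<open>k\<close> in favour of \<open>u k\<close>. Swapping
  \<open>u i\<close> for \<open>u j\<close> in \<open>vertex i\<close> gives the inequalities of the order cone.\<close>

lemma normal_cone_sweep_polytope:
  fixes u :: "nat \<Rightarrow> 'v::euclidean_space" and r :: nat
  assumes x: "x \<in> span N"
  defines "P \<equiv> sweep_polytope r u"
  shows "\<exists>F. F face_of P \<and> F \<noteq> {} \<and> normal_cone N P F = order_cone (span N) {1..r} u x"
proof -
  define pick where "pick = (\<lambda>(i::nat, j) k. u (if u i \<bullet> x < u j \<bullet> x \<or> u i \<bullet> x = u j \<bullet> x \<and> k = j then j else i))"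
  define vertex where "vertex = (\<lambda>k. \<Sum>p\<in>index_pairs r. pick p k)"
  \<comment> \<open>\<open>M\<close> is the maximum of \<open>x\<close> on \<open>P\<close>. As
    \<open>0\<close> is not an index, \<open>vertex 0\<close> resolves every tie to the first
    endpoint; by \<open>vertex_x\<close> all choices of \<open>k\<close> give the same
    value.\<close>
  define M where "M = vertex 0 \<bullet> x"
  define F where "F = P \<inter> {p. x \<bullet> p = M}"
  have pick_max: "q \<bullet> x \<le> pick (i, j) k \<bullet> x" if "q \<in> closed_segment (u i) (u j)" for q i j k
    using closed_segment_inner_le[OF that] by (auto simp: pick_def)
  have vertex_P: "vertex k \<in> P" for k
    unfolding P_def sweep_polytope_eq vertex_def by (auto simp: pick_def)
  have vertex_x: "vertex k \<bullet> x = M" for k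
    unfolding M_def vertex_def inner_sum_left by (intro sum.cong) (auto simp: pick_def)
  have max: "q \<bullet> x \<le> M" if "q \<in> P" for q
    using that unfolding P_def sweep_polytope_eq M_def vertex_def
    by (auto simp: inner_sum_left intro!: sum_mono pick_max)
  have "F face_of P"
    unfolding F_def using max convex_sweep_polytope[of r u]
    by (intro face_of_Int_supporting_hyperplane_le) (auto simp: P_def inner_commute)
  moreover have vertex_F: "vertex k \<in> F" for k
    using vertex_P vertex_x by (simp add: F_def inner_commute)
  moreover have "normal_cone N P F = order_cone (span N) {1..r} u x"
  proof (intro equalityI subsetI)
    fix y assume y: "y \<in> normal_cone N P F"
    show "y \<in> order_cone (span N) {1..r} u x"
    proof -
      have "u j \<bullet> y \<le> u i \<bullet> y"
        if ij: "i \<in> {1..r}" "j \<in> {1..r}" and le: "u j \<bullet> x \<le> u i \<bullet> x" for i j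
      proof (cases "i = j")
        case False
        \<comment> \<open>The segment joining \<open>u i\<close> and \<open>u j\<close> is indexed
          only by the increasing pair.\<close>
        define a where "a = (min i j, max i j)"
        have a: "a \<in> index_pairs r"
          using ij False by (auto simp: a_def)
        have "pick a i = u i"
          using le False by (auto simp: a_def pick_def min_def max_def)
        moreover have "sum ((\<lambda>p. pick p i)(a := u j)) (index_pairs r) \<in> P"
        proof -
          have "u j \<in> closed_segment (u (fst a)) (u (snd a))"
            by (auto simp: a_def min_def max_def)
          moreover have "pick (k, l) i \<in> closed_segment (u k) (u l)" for k l
            by (auto simp: pick_def)
          ultimately show ?thesis
            unfolding P_def sweep_polytope_eq by (force simp: fun_upd_def)
        qed
        then have "sum ((\<lambda>p. pick p i)(a := u j)) (index_pairs r) \<bullet> y \<le> vertex i \<bullet> y"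
          using y vertex_F by (auto simp: normal_cone_def)
        ultimately show ?thesis
          unfolding sum_fun_upd[OF finite_index_pairs a] by (simp add: vertex_def inner_simps)
      qed simp
      then show ?thesis
        using y by (simp add: order_cone_def normal_cone_def)
    qed
  next
    fix y assume y: "y \<in> order_cone (span N) {1..r} u x"
    \<comment> \<open>A point of \<open>F\<close> maximizes \<open>x\<close> in every summand
      separately, and on a segment the inequalities of the order cone turn a maximizer of
      \<open>x\<close> into a maximizer of \<open>y\<close>.\<close>
    have "q \<bullet> y \<le> p \<bullet> y" if p: "p \<in> F" and q: "q \<in> P" for p q
    proof -
      obtain s where s: "p = sum s (index_pairs r)"
          "\<And>i j. (i, j) \<in> index_pairs r \<Longrightarrow> s (i, j) \<in> closed_segment (u i) (u j)"
        using p unfolding F_def P_def sweep_polytope_eq by blast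
      obtain t where t: "q = sum t (index_pairs r)"
          "\<And>i j. (i, j) \<in> index_pairs r \<Longrightarrow> t (i, j) \<in> closed_segment (u i) (u j)"
        using q unfolding P_def sweep_polytope_eq by blast
      have "t a \<bullet> y \<le> s a \<bullet> y" if a: "a \<in> index_pairs r" for a
      proof -
        obtain i j where ij: "a = (i, j)"
          by fastforce
        then have I: "i \<in> {1..r}" "j \<in> {1..r}"
          using a by auto
        have s_max: "v \<bullet> x \<le> s a \<bullet> x" if "v \<in> closed_segment (u i) (u j)" for v
        proof -
          \<comment> \<open>Exchanging a single summand stays in \<open>P\<close>, where
            \<open>p\<close> is maximal for \<open>x\<close>.\<close>
          have "sum (s(a := v)) (index_pairs r) \<in> P"
            unfolding P_def sweep_polytope_eq using s(2) that ij by force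
          then have "sum (s(a := v)) (index_pairs r) \<bullet> x \<le> p \<bullet> x"
            using max[of "sum (s(a := v)) (index_pairs r)"] p by (simp add: F_def inner_commute[of p])
          then show ?thesis
            unfolding sum_fun_upd[OF finite_index_pairs a] by (simp add: s(1) inner_simps)
        qed
        have sa: "s a \<in> closed_segment (u i) (u j)" and ta: "t a \<in> closed_segment (u i) (u j)"
          using s(2) t(2) a ij by auto
        consider "u i \<bullet> x < u j \<bullet> x" | "u j \<bullet> x < u i \<bullet> x" | "u i \<bullet> x = u j \<bullet> x"
          by linarith
        then show ?thesis
        proof cases
          case 1
          then have "s a = u j"
            using closed_segment_max[OF sa] s_max by simp
          then show ?thesis
            using 1 y I by (auto intro!: closed_segment_inner_le[OF ta] simp: order_cone_def)
        next
          case 2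
          then have "s a = u i"
            using closed_segment_max[of "s a" "u j" "u i"] sa s_max by (simp add: closed_segment_commute)
          then show ?thesis
            using 2 y I by (auto intro!: closed_segment_inner_le[OF ta] simp: order_cone_def)
        next
          case 3
          then have "u i \<bullet> y \<le> u j \<bullet> y" "u j \<bullet> y \<le> u i \<bullet> y"
            using y I by (simp_all add: order_cone_def)
          \<comment> \<open>On a tie \<open>y\<close> is constant on the segment; the lower bound
            for \<open>s a\<close> is the upper bound taken for \<open>- y\<close>.\<close>
          then have "t a \<bullet> y \<le> u i \<bullet> y" "- (s a \<bullet> y) \<le> - (u i \<bullet> y)"
            using closed_segment_inner_le[OF ta, of y "u i \<bullet> y"]
              closed_segment_inner_le[OF sa, of "- y" "- (u i \<bullet> y)"] by simp_all
          then show ?thesis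
            by simp
        qed
      qed
      then show ?thesis
        unfolding s(1) t(1) inner_sum_left by (rule sum_mono)
    qed
    then show "y \<in> normal_cone N P F"
      using y by (simp add: order_cone_def normal_cone_def)
  qed
  ultimately show ?thesis
    by blast
qed

text \<open>The order cone at \<open>x\<close> is a normal cone and has the required relative
  interior, and no other cone of the sweep fan has the same one; so the description defining
  \<open>sweep_cone\<close> is meaningful.\<close>

lemma rel_interior_sweep_cone:
  assumes "x \<in> span N"
  shows "rel_interior (sweep_cone N r u (sweep r u x)) = {y\<in>span N. sweep r u y = sweep r u x}"
proof -
  obtain F where F: "F face_of sweep_polytope r u" "F \<noteq> {}"
      "normal_cone N (sweep_polytope r u) F = order_cone (span N) {1..r} u x"
    using normal_cone_sweep_polytope[OF assms] by blast
  have "\<exists>!C. C \<in> sweep_fan N r u \<and> rel_interior C = {y\<in>span N. sweep r u y = sweep r u x}"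
  proof (rule ex1I[of _ "normal_cone N (sweep_polytope r u) F"])
    show "normal_cone N (sweep_polytope r u) F \<in> sweep_fan N r u \<and>
        rel_interior (normal_cone N (sweep_polytope r u) F) = {y\<in>span N. sweep r u y = sweep r u x}"
      using F rel_interior_sweep_order_cone[OF assms, of r u]
      unfolding sweep_fan_def normal_fan_def by auto
  next
    fix D
    assume D: "D \<in> sweep_fan N r u \<and> rel_interior D = {y\<in>span N. sweep r u y = sweep r u x}"
    then obtain G where G: "D = normal_cone N (sweep_polytope r u) G"
      unfolding sweep_fan_def normal_fan_def by blast
    show "D = normal_cone N (sweep_polytope r u) F"
      unfolding G
      by (rule normal_cone_rel_interior_inject)
        (use D F(3) rel_interior_sweep_order_cone[OF assms, of r u] in \<open>simp add: G\<close>)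
  qed
  from theI'[OF this] show ?thesis
    unfolding sweep_cone_def by blast
qed

section \<open>The Bergman fan\<close>

lemma e_vec_nth: "e_vec S $ i = (if i \<in> S then 1 else 0)"
  by (simp add: e_vec_def axis_def if_distrib[of "\<lambda>f. f _"] cong: if_cong)

text \<open>This is \<open>flags_of_flats\<close> without flatness: the shape of a Bergman cone
  depends on the chain alone, not on the matroid.\<close>

definition chain_with_top :: "'a set list \<Rightarrow> bool" where
  "chain_with_top \<F> \<longleftrightarrow> \<F> \<noteq> [] \<and> sorted_wrt (\<subset>) ({} # \<F>) \<and> last \<F> = UNIV"

lemma sorted_psubset_chain: "sorted_wrt (\<subset>) xs \<Longrightarrow> subset.chain UNIV (set xs)"
  by (induction xs) (auto simp: subset_chain_def)

lemma chain_with_top_chain: "chain_with_top \<F> \<Longrightarrow> subset.chain UNIV (set \<F>)"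
  by (simp add: chain_with_top_def sorted_psubset_chain)

lemma in_set_butlastI: "x \<in> set xs \<Longrightarrow> x \<noteq> last xs \<Longrightarrow> x \<in> set (butlast xs)"
  by (cases xs rule: rev_cases) auto

lemma chain_with_top_UNIV: "chain_with_top \<F> \<Longrightarrow> UNIV \<in> set \<F>"
  unfolding chain_with_top_def using last_in_set[of \<F>] by simp

lemma chain_with_top_nonempty: "chain_with_top \<F> \<Longrightarrow> {} \<notin> set \<F>"
  by (auto simp: chain_with_top_def)

lemma chain_with_top_butlast:
  "chain_with_top \<F> \<Longrightarrow> F \<in> set \<F> \<Longrightarrow> F \<noteq> UNIV \<Longrightarrow> F \<in> set (butlast \<F>)"
  by (simp add: chain_with_top_def in_set_butlastI)

text \<open>Such a \<open>D\<close> is the union of the smallest members \<open>m d\<close> of the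
  chain containing \<open>d\<close>, for \<open>d\<close> in \<open>D\<close>, and a finite nonempty
  union of members of a chain is one of them.\<close>

lemma upclosed_in_chain:
  fixes \<F> :: "'e::finite set list"
  assumes \<F>: "chain_with_top \<F>" and D: "D \<noteq> {}"
    and up: "\<And>p q. q \<in> D \<Longrightarrow> \<forall>G\<in>set \<F>. q \<in> G \<longrightarrow> p \<in> G \<Longrightarrow> p \<in> D"
  shows "D \<in> set \<F>"
proof -
  \<comment> \<open>The intersection is over a nonempty family because \<open>UNIV\<close> is a
    member, so \<open>m d\<close> is itself in the chain.\<close>
  define m where "m = (\<lambda>d. \<Inter>{G\<in>set \<F>. d \<in> G})"
  have m: "m d \<in> set \<F>" for d
  proof -
    have "\<Inter>{G\<in>set \<F>. d \<in> G} \<in> {G\<in>set \<F>. d \<in> G}"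
      using chain_with_top_chain[OF \<F>] chain_with_top_UNIV[OF \<F>]
      by (intro Inter_in_chain[where \<A> = UNIV]) (auto simp: subset_chain_def)
    then show ?thesis
      by (simp add: m_def)
  qed
  have "\<Union>(m ` D) \<in> m ` D"
    using chain_with_top_chain[OF \<F>] m D
    by (intro Union_in_chain[where \<A> = UNIV]) (auto simp: subset_chain_def)
  moreover have "\<Union>(m ` D) = D"
    using up by (auto simp: m_def)
  ultimately show ?thesis
    using m by auto
qed

section \<open>Bergman cones as order cones\<close>

lemma bergman_cone_add_e_vec:
  assumes "F \<in> set (butlast \<F>)" "v \<in> bergman_cone \<F>" "0 \<le> c"
  shows "v + c *\<^sub>R e_vec F \<in> bergman_cone \<F>"
proof -
  obtain x y where v: "v = x + y" "x \<in> convex_cone hull (e_vec ` set (butlast \<F>))"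
      "y \<in> span {e_vec UNIV}"
    using assms(2) by (auto simp: bergman_cone_def)
  have "e_vec F \<in> convex_cone hull (e_vec ` set (butlast \<F>))"
    using assms(1) by (intro hull_inc) simp
  then have "x + c *\<^sub>R e_vec F \<in> convex_cone hull (e_vec ` set (butlast \<F>))"
    using v(2) assms(3) by (intro convex_cone_hull_add convex_cone_hull_mul)
  moreover have "v + c *\<^sub>R e_vec F = (x + c *\<^sub>R e_vec F) + y"
    by (simp add: v(1))
  ultimately show ?thesis
    using v(3) unfolding bergman_cone_def by blast
qed

text \<open>Induction on the number of values: cutting the maximum of \<open>v\<close> down to the second largest
  value subtracts a multiple of \<open>e_vec\<close> of a superlevel set.\<close>

lemma in_bergman_coneI:
  fixes v :: "real ^ 'e::finite"
  assumes \<F>: "chain_with_top \<F>" and v: "\<And>i. {j. v $ i \<le> v $ j} \<in> set \<F>"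
  shows "v \<in> bergman_cone \<F>"
  using v
proof (induction "card (range (($) v))" arbitrary: v rule: less_induct)
  case less
  define M where "M = Max (range (($) v))"
  have M_max: "v $ i \<le> M" for i
    by (simp add: M_def)
  have "M \<in> range (($) v)"
    unfolding M_def by (rule Max_in) auto
  then obtain i0 where i0: "v $ i0 = M"
    by auto
  show ?case
  proof (cases "range (($) v) = {M}")
    case True
    then have "v = M *\<^sub>R e_vec UNIV"
      by (auto simp: vec_eq_iff e_vec_nth)
    then have "v = 0 + M *\<^sub>R e_vec UNIV"
      by simp
    then show ?thesis
      unfolding bergman_cone_def using convex_cone_hull_contains_0 span_base span_mul by blast
  next
    case False
    then have ne: "range (($) v) - {M} \<noteq> {}"
      using i0 by blast
    define m where "m = Max (range (($) v) - {M})"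
    have "m \<in> range (($) v) - {M}"
      unfolding m_def by (rule Max_in) (use ne in auto)
    then obtain j0 where j0: "v $ j0 = m" "m < M"
      using M_max by (force simp: order_le_less)
    have below: "v $ i \<le> m" if "v $ i \<noteq> M" for i
      unfolding m_def by (rule Max_ge) (use that in auto)
    define G where "G = {j. M \<le> v $ j}"
    define w where "w = v - (M - m) *\<^sub>R e_vec G"
    have w: "w $ i = min (v $ i) m" for i
    proof (cases "v $ i = M")
      case False
      then have "v $ i < M"
        using M_max[of i] by simp
      then show ?thesis
        using below[OF False] by (simp add: w_def G_def e_vec_nth)
    qed (use j0(2) in \<open>simp add: w_def G_def e_vec_nth\<close>)
    have "range (($) w) \<subseteq> range (($) v) - {M}"
    proof
      fix t assume "t \<in> range (($) w)"
      then obtain i where "t = min (v $ i) m"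
        by (auto simp: w)
      then have "t = v $ i \<and> t < M \<or> t = v $ j0"
        using j0 by (auto simp: min_def)
      then show "t \<in> range (($) v) - {M}"
        using j0 by auto
    qed
    then have "card (range (($) w)) < card (range (($) v))"
      using \<open>M \<in> range (($) v)\<close> by (intro psubset_card_mono[OF finite_imageI[OF finite]]) blast
    \<comment> \<open>Where \<open>v\<close> was maximal, the superlevel set of \<open>w\<close> is
      that of \<open>v\<close> at the second value \<open>m\<close>; elsewhere it is unchanged. The
      chain hypothesis thus survives the cut.\<close>
    moreover have "{j. w $ i \<le> w $ j} \<in> set \<F>" for i
    proof (cases "v $ i = M")
      case True
      then have "w $ i = m"
        using j0(2) by (simp add: w)
      then have "{j. w $ i \<le> w $ j} = {j. v $ j0 \<le> v $ j}"
        unfolding w[of j for j] j0(1) by simp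
      then show ?thesis
        using less.prems by simp
    next
      case False
      then have "{j. w $ i \<le> w $ j} = {j. v $ i \<le> v $ j}"
        using below[OF False] by (simp add: w)
      then show ?thesis
        using less.prems by simp
    qed
    ultimately have "w \<in> bergman_cone \<F>"
      by (rule less.hyps)
    \<comment> \<open>\<open>j0\<close> lies outside \<open>G\<close>, so \<open>G\<close> is not
      the top of the chain and \<open>e_vec G\<close> is among the generators.\<close>
    moreover have "G \<in> set (butlast \<F>)"
    proof (rule chain_with_top_butlast[OF \<F>])
      show "G \<in> set \<F>"
        using less.prems[of i0] by (simp add: G_def i0)
      show "G \<noteq> UNIV"
        using j0 by (auto simp: G_def set_eq_iff not_le)
    qed
    ultimately have "w + (M - m) *\<^sub>R e_vec G \<in> bergman_cone \<F>"
      using j0(2) by (intro bergman_cone_add_e_vec) auto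
    then show ?thesis
      by (simp add: w_def)
  qed
qed

text \<open>The inequality holds for each generator \<open>e_vec F\<close> and defines a convex
  cone; the lineality part has equal coordinates.\<close>

lemma bergman_cone_mono:
  assumes v: "v \<in> bergman_cone \<F>" and ij: "\<forall>F\<in>set \<F>. j \<in> F \<longrightarrow> i \<in> F"
  shows "v $ j \<le> v $ i"
proof -
  obtain x y where xy: "v = x + y" "x \<in> convex_cone hull (e_vec ` set (butlast \<F>))"
      "y \<in> span {e_vec UNIV}"
    using v by (auto simp: bergman_cone_def)
  have "convex_cone hull (e_vec ` set (butlast \<F>)) \<subseteq> {x. x $ j \<le> x $ i}"
  proof (rule hull_minimal)
    show "e_vec ` set (butlast \<F>) \<subseteq> {x. x $ j \<le> x $ i}"
      using ij by (auto simp: e_vec_nth dest: in_set_butlastD)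
    show "convex_cone {x::real^'a. x $ j \<le> x $ i}"
      by (auto simp: convex_cone_iff add_mono mult_left_mono)
  qed
  then have "x $ j \<le> x $ i"
    using xy(2) by blast
  moreover have "y $ j = y $ i"
    using xy(3) by (auto simp: span_singleton e_vec_nth)
  ultimately show ?thesis
    by (simp add: xy(1))
qed

text \<open>Coordinate \<open>i\<close> of \<open>x\<close> counts the members of the chain
  containing \<open>i\<close>, and in a chain comparing counts amounts to comparing membership. For
  \<open>v\<close> in the order cone the superlevel sets are closed upwards for this preorder, hence
  members of the chain, and \<open>in_bergman_coneI\<close> applies.\<close>

lemma bergman_cone_eq_order_cone:
  fixes \<F> :: "'e::finite set list"
  assumes \<F>: "chain_with_top \<F>"
  defines "x \<equiv> \<Sum>F\<in>set \<F>. e_vec F"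
  shows "x $ j \<le> x $ i \<longleftrightarrow> (\<forall>F\<in>set \<F>. j \<in> F \<longrightarrow> i \<in> F)"
    and "bergman_cone \<F> = order_cone UNIV UNIV (\<lambda>i. axis i 1) x"
proof -
  have x: "x $ i = card {F\<in>set \<F>. i \<in> F}" for i
    by (simp add: x_def e_vec_nth Collect_conj_eq flip: sum.inter_filter)
  show iff: "x $ j \<le> x $ i \<longleftrightarrow> (\<forall>F\<in>set \<F>. j \<in> F \<longrightarrow> i \<in> F)" for i j
  proof
    assume le: "x $ j \<le> x $ i"
    show "\<forall>F\<in>set \<F>. j \<in> F \<longrightarrow> i \<in> F"
    proof (intro ballI impI, rule ccontr)
      fix F assume F: "F \<in> set \<F>" "j \<in> F" "i \<notin> F"
      then have "{F\<in>set \<F>. i \<in> F} \<subset> {F\<in>set \<F>. j \<in> F}"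
        using chain_with_top_chain[OF \<F>] by (auto simp: subset_chain_def)
      then have "x $ i < x $ j"
        by (simp add: x psubset_card_mono)
      then show False
        using le by simp
    qed
  next
    assume "\<forall>F\<in>set \<F>. j \<in> F \<longrightarrow> i \<in> F"
    then show "x $ j \<le> x $ i"
      by (auto simp: x intro!: card_mono)
  qed
  show "bergman_cone \<F> = order_cone UNIV UNIV (\<lambda>i. axis i 1) x"
  proof (intro equalityI subsetI)
    fix v assume "v \<in> bergman_cone \<F>"
    then show "v \<in> order_cone UNIV UNIV (\<lambda>i. axis i 1) x"
      using bergman_cone_mono by (auto simp: order_cone_def inner_axis' iff)
  next
    fix v assume v: "v \<in> order_cone UNIV UNIV (\<lambda>i. axis i 1) x"
    have "{j. v $ i \<le> v $ j} \<in> set \<F>" for i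
    proof (rule upclosed_in_chain[OF \<F>])
      fix p q assume "q \<in> {j. v $ i \<le> v $ j}" "\<forall>G\<in>set \<F>. q \<in> G \<longrightarrow> p \<in> G"
      moreover then have "v $ q \<le> v $ p"
        using v by (simp add: order_cone_def inner_axis' flip: iff)
      ultimately show "p \<in> {j. v $ i \<le> v $ j}"
        by simp
    qed auto
    then show "v \<in> bergman_cone \<F>"
      by (rule in_bergman_coneI[OF \<F>])
  qed
qed

text \<open>Superlevel sets are closed upwards for the preorder of the chain, hence are members;
  conversely each member is the superlevel set at the least value of \<open>f\<close> on it.\<close>

lemma superlevel_flag_eq_chainI:
  fixes \<F> :: "'e::finite set list"
  assumes \<F>: "chain_with_top \<F>"
    and iff: "\<And>i j. f j \<le> f i \<longleftrightarrow> (\<forall>F\<in>set \<F>. j \<in> F \<longrightarrow> i \<in> F)"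
  shows "superlevel_flag UNIV f = \<F>"
proof (rule sorted_psubset_unique)
  show "set (superlevel_flag UNIV f) = set \<F>"
  proof (intro equalityI subsetI)
    fix F assume "F \<in> set (superlevel_flag UNIV f)"
    then obtain i where F: "F = {j. f i \<le> f j}"
      by (auto simp: set_superlevel_flag)
    show "F \<in> set \<F>"
    proof (rule upclosed_in_chain[OF \<F>])
      show "F \<noteq> {}"
        using F by auto
      show "p \<in> F" if "q \<in> F" "\<forall>G\<in>set \<F>. q \<in> G \<longrightarrow> p \<in> G" for p q
        using that unfolding F iff by blast
    qed
  next
    fix F assume F: "F \<in> set \<F>"
    then have "F \<noteq> {}"
      using chain_with_top_nonempty[OF \<F>] by metis
    then obtain i where i: "i \<in> F" "\<And>j. j \<in> F \<Longrightarrow> f i \<le> f j"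
      using ex_is_arg_min_if_finite[of F f] by (auto simp: is_arg_min_linorder)
    moreover have "j \<in> F" if "f i \<le> f j" for j
      using iff[THEN iffD1, OF that] F i(1) by blast
    ultimately have "F = {j. f i \<le> f j}"
      by blast
    then show "F \<in> set (superlevel_flag UNIV f)"
      by (auto simp: set_superlevel_flag)
  qed
  show "sorted_wrt (\<subset>) (superlevel_flag UNIV f)" "sorted_wrt (\<subset>) \<F>"
    using \<F> sorted_superlevel_flag[of UNIV f] unfolding chain_with_top_def by simp_all
qed

text \<open>The sum of the \<open>e_vec F\<close> has superlevel flag \<open>\<F>\<close>, and the
  relative interior of its order cone consists of the points inducing the same weak order of
  coordinates, that is, the same flag.\<close>

lemma rel_interior_bergman_cone:
  fixes \<F> :: "'e::finite set list"
  assumes \<F>: "chain_with_top \<F>"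
  shows "v \<in> rel_interior (bergman_cone \<F>) \<longleftrightarrow> superlevel_flag UNIV (($) v) = \<F>"
proof -
  let ?x = "\<Sum>F\<in>set \<F>. e_vec F"
  have "superlevel_flag UNIV (($) ?x) = \<F>"
    using \<F> bergman_cone_eq_order_cone(1)[OF \<F>] by (rule superlevel_flag_eq_chainI)
  moreover have "v \<in> rel_interior (bergman_cone \<F>) \<longleftrightarrow>
      superlevel_flag UNIV (($) ?x) = superlevel_flag UNIV (($) v)"
    unfolding bergman_cone_eq_order_cone(2)[OF \<F>] superlevel_flag_eq_iff[OF finite]
      rel_interior_order_cone[OF subspace_UNIV finite UNIV_I]
    by (simp add: inner_axis')
  ultimately show ?thesis
    by auto
qed

lemma chain_with_top_superlevel_flag:
  fixes f :: "'e::finite \<Rightarrow> real"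
  shows "chain_with_top (superlevel_flag UNIV f)"
proof -
  let ?\<F> = "superlevel_flag UNIV f"
  obtain i where i: "\<And>j. f i \<le> f j"
    using ex_is_arg_min_if_finite[of UNIV f] by (auto simp: is_arg_min_linorder)
  then have U: "UNIV \<in> set ?\<F>"
    by (auto simp: set_superlevel_flag intro!: image_eqI[of _ _ i])
  then have ne: "?\<F> \<noteq> []"
    by auto
  have sorted: "sorted_wrt (\<subset>) ({} # ?\<F>)"
    by (rule sorted_superlevel_flag) simp
  have "last ?\<F> = UNIV"
  proof (rule ccontr)
    assume "last ?\<F> \<noteq> UNIV"
    then have "UNIV \<in> set (butlast ?\<F>)"
      using U by (intro in_set_butlastI) auto
    \<comment> \<open>Before the last position, \<open>UNIV\<close> would be a proper subset of the
      last member.\<close>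
    moreover have "sorted_wrt (\<subset>) (butlast ?\<F> @ [last ?\<F>])"
      using sorted ne by simp
    ultimately show False
      unfolding sorted_wrt_append by auto
  qed
  then show ?thesis
    using ne sorted by (simp add: chain_with_top_def)
qed

text \<open>By \<open>rel_interior_bergman_cone\<close> the superlevel flag is the only candidate
  for \<open>flag_at\<close>; the hypothesis makes it a flag of flats.\<close>

lemma flag_at_eq_superlevel_flag:
  assumes "\<And>i. is_flat \<I> {j. v $ i \<le> v $ j}"
  shows "superlevel_flag UNIV (($) v) \<in> flags_of_flats \<I>"
    and "flag_at \<I> v = superlevel_flag UNIV (($) v)"
proof -
  have flags: "\<F> \<in> flags_of_flats \<I> \<longleftrightarrow> chain_with_top \<F> \<and> (\<forall>F\<in>set \<F>. is_flat \<I> F)" for \<F>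
    by (auto simp: flags_of_flats_def chain_with_top_def)
  show mem: "superlevel_flag UNIV (($) v) \<in> flags_of_flats \<I>"
    using assms chain_with_top_superlevel_flag by (auto simp: flags set_superlevel_flag)
  show "flag_at \<I> v = superlevel_flag UNIV (($) v)"
    unfolding flag_at_def
    by (rule the_equality) (use mem in \<open>auto simp: flags rel_interior_bergman_cone\<close>)
qed

section \<open>Closures of independent sets\<close>

lemma matroid_subset: "matroid \<I> \<Longrightarrow> A \<in> \<I> \<Longrightarrow> B \<subseteq> A \<Longrightarrow> B \<in> \<I>"
  unfolding matroid_def by blast

lemma matroid_exchange:
  assumes "matroid \<I>" "A \<in> \<I>" "B \<in> \<I>" "card A < card B"
  obtains x where "x \<in> B - A" "insert x A \<in> \<I>"
  using assms unfolding matroid_def by blast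

lemma card_le_matroid_rank:
  fixes \<I> :: "'e::finite set set"
  shows "A \<in> \<I> \<Longrightarrow> A \<subseteq> S \<Longrightarrow> card A \<le> matroid_rank \<I> S"
  unfolding matroid_rank_def by (rule Max_ge) auto

lemma matroid_rank_witness:
  fixes \<I> :: "'e::finite set set"
  assumes "matroid \<I>"
  obtains A where "A \<in> \<I>" "A \<subseteq> S" "card A = matroid_rank \<I> S"
proof -
  have "{card A | A. A \<in> \<I> \<and> A \<subseteq> S} \<noteq> {}"
    using assms by (auto simp: matroid_def)
  then have "matroid_rank \<I> S \<in> {card A | A. A \<in> \<I> \<and> A \<subseteq> S}"
    unfolding matroid_rank_def by (intro Max_in) auto
  then show ?thesis
    using that by auto
qed

lemma matroid_rank_indep:
  fixes \<I> :: "'e::finite set set"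
  assumes "matroid \<I>" "A \<in> \<I>"
  shows "matroid_rank \<I> A = card A"
proof -
  obtain X where "X \<in> \<I>" "X \<subseteq> A" "card X = matroid_rank \<I> A"
    using matroid_rank_witness[OF assms(1)] .
  then have "matroid_rank \<I> A \<le> card A"
    by (metis card_mono finite)
  then show ?thesis
    using card_le_matroid_rank[OF assms(2), of A] by simp
qed

text \<open>If \<open>insert x A\<close> is dependent, its independent subsets are proper and so no
  larger than \<open>A\<close>. This replaces ranks by independence in the arguments below.\<close>

lemma in_matroid_closure_iff:
  fixes \<I> :: "'e::finite set set"
  assumes \<I>: "matroid \<I>" and A: "A \<in> \<I>"
  shows "x \<in> matroid_closure \<I> A \<longleftrightarrow> x \<in> A \<or> insert x A \<notin> \<I>"
proof -
  have rk: "matroid_rank \<I> A = card A"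
    using assms by (rule matroid_rank_indep)
  consider "x \<in> A" | "x \<notin> A" "insert x A \<in> \<I>" | "x \<notin> A" "insert x A \<notin> \<I>"
    by blast
  then show ?thesis
  proof cases
    case 1
    then show ?thesis
      by (simp add: matroid_closure_def insert_absorb)
  next
    case 2
    then show ?thesis
      using matroid_rank_indep[OF \<I> 2(2)] by (simp add: matroid_closure_def rk)
  next
    case 3
    obtain X where X: "X \<in> \<I>" "X \<subseteq> insert x A" "card X = matroid_rank \<I> (insert x A)"
      using matroid_rank_witness[OF \<I>] .
    then have "X \<subset> insert x A"
      using 3 by blast
    then have "card X < card (insert x A)"
      by (intro psubset_card_mono) auto
    then have "matroid_rank \<I> (insert x A) \<le> card A"
      using 3 X(3) by simp
    moreover have "card A \<le> matroid_rank \<I> (insert x A)"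
      using A by (intro card_le_matroid_rank) auto
    ultimately show ?thesis
      using 3 rk by (simp add: matroid_closure_def)
  qed
qed

text \<open>A larger independent subset of the closure would, by exchange, supply an element of the
  closure that extends \<open>A\<close> independently.\<close>

lemma matroid_rank_closure:
  fixes \<I> :: "'e::finite set set"
  assumes \<I>: "matroid \<I>" and A: "A \<in> \<I>"
  shows "matroid_rank \<I> (matroid_closure \<I> A) = card A"
proof (rule antisym)
  obtain X where X: "X \<in> \<I>" "X \<subseteq> matroid_closure \<I> A"
      "card X = matroid_rank \<I> (matroid_closure \<I> A)"
    using matroid_rank_witness[OF \<I>] .
  show "matroid_rank \<I> (matroid_closure \<I> A) \<le> card A"
  proof (rule ccontr)
    assume "\<not> ?thesis"
    then obtain x where "x \<in> X - A" "insert x A \<in> \<I>"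
      using matroid_exchange[OF \<I> A X(1)] X(3) by auto
    then show False
      using X(2) in_matroid_closure_iff[OF assms] by blast
  qed
  show "card A \<le> matroid_rank \<I> (matroid_closure \<I> A)"
    using A by (intro card_le_matroid_rank) (auto simp: in_matroid_closure_iff[OF assms])
qed

text \<open>A point \<open>x\<close> outside the closure makes \<open>insert x A\<close>
  independent, so adding \<open>x\<close> to the closure raises the rank above
  \<open>card A\<close>.\<close>

lemma is_flat_closure:
  fixes \<I> :: "'e::finite set set"
  assumes \<I>: "matroid \<I>" and A: "A \<in> \<I>"
  shows "is_flat \<I> (matroid_closure \<I> A)"
proof -
  have "x \<in> matroid_closure \<I> A" if x: "x \<in> matroid_closure \<I> (matroid_closure \<I> A)" for x
  proof (rule ccontr)
    assume "x \<notin> matroid_closure \<I> A"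
    then have "x \<notin> A" "insert x A \<in> \<I>"
      by (auto simp: in_matroid_closure_iff[OF assms])
    moreover have "insert x A \<subseteq> insert x (matroid_closure \<I> A)"
      by (auto simp: in_matroid_closure_iff[OF assms])
    ultimately have "Suc (card A) \<le> matroid_rank \<I> (insert x (matroid_closure \<I> A))"
      using card_le_matroid_rank[of "insert x A" \<I>] by simp
    then show False
      using x matroid_rank_closure[OF assms]
      by (simp add: matroid_closure_def[of \<I> "matroid_closure \<I> A"])
  qed
  moreover have "x \<in> matroid_closure \<I> (matroid_closure \<I> A)" if "x \<in> matroid_closure \<I> A" for x
    using that by (simp add: matroid_closure_def[of \<I> "matroid_closure \<I> A"] insert_absorb)
  ultimately show ?thesis
    unfolding is_flat_def by blast
qed

lemma matroid_augment:
  fixes \<I> :: "'e::finite set set"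
  assumes \<I>: "matroid \<I>" and "A \<in> \<I>" "B \<in> \<I>" "card A \<le> card B"
  shows "\<exists>X\<in>\<I>. A \<subseteq> X \<and> X \<subseteq> A \<union> B \<and> card X = card B"
  using assms(2,4)
proof (induction "card B - card A" arbitrary: A)
  case 0
  then show ?case by auto
next
  case (Suc n)
  then obtain x where x: "x \<in> B - A" "insert x A \<in> \<I>"
    using matroid_exchange[OF \<I> Suc.prems(1) \<open>B \<in> \<I>\<close>] by force
  then have "\<exists>X\<in>\<I>. insert x A \<subseteq> X \<and> X \<subseteq> insert x A \<union> B \<and> card X = card B"
    using Suc.hyps(2) by (intro Suc.hyps(1)) auto
  then show ?case
    using x by blast
qed

section \<open>Circuits and fundamental circuits\<close>

lemma dependent_contains_circuit:
  fixes \<I> :: "'e::finite set set"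
  assumes "X \<notin> \<I>"
  shows "\<exists>C\<subseteq>X. is_circuit \<I> C"
  using finite[of X] assms
proof (induction X rule: finite_psubset_induct)
  case (psubset X)
  show ?case
  proof (cases "is_circuit \<I> X")
    case False
    then obtain A where "A \<subset> X" "A \<notin> \<I>"
      using psubset.prems by (auto simp: is_circuit_def)
    then show ?thesis
      using psubset.IH[of A] by blast
  qed blast
qed

text \<open>Remove from \<open>C\<close> an element \<open>f\<close> outside \<open>D\<close> and
  extend the rest by elements of \<open>B\<close> to an independent set of size
  \<open>card B\<close>. By counting, this set is \<open>insert i B - {f}\<close>, which contains
  the dependent set \<open>D\<close>.\<close>

lemma is_circuit_unique:
  fixes \<I> :: "'e::finite set set"
  assumes \<I>: "matroid \<I>" and B: "B \<in> \<I>"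
    and C: "is_circuit \<I> C" "C \<subseteq> insert i B" and D: "is_circuit \<I> D" "D \<subseteq> insert i B"
  shows "C = D"
proof (rule ccontr)
  assume "C \<noteq> D"
  moreover have "\<not> C \<subset> D"
    using C(1) D(1) by (auto simp: is_circuit_def)
  ultimately obtain f where f: "f \<in> C" "f \<notin> D"
    by blast
  have i: "i \<notin> B"
    using C B matroid_subset[OF \<I> B] by (auto simp: is_circuit_def insert_absorb)
  have Cf: "C - {f} \<in> \<I>"
    using C(1) f by (auto simp: is_circuit_def)
  have "card C \<le> Suc (card B)"
    using card_mono[OF _ C(2)] i by simp
  then have "card (C - {f}) \<le> card B"
    using f(1) by simp
  then obtain X where X: "X \<in> \<I>" "C - {f} \<subseteq> X" "X \<subseteq> C - {f} \<union> B" "card X = card B"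
    using matroid_augment[OF \<I> Cf B] by blast
  \<comment> \<open>Otherwise \<open>X\<close> would contain all of \<open>C\<close>.\<close>
  have "f \<notin> X"
    using matroid_subset[OF \<I> X(1), of C] X(2) C(1) by (auto simp: is_circuit_def)
  then have "X \<subseteq> insert i B - {f}"
    using X(3) C(2) by blast
  moreover have "card (insert i B - {f}) = card X"
    using f(1) C(2) i X(4) by (simp add: subset_iff)
  ultimately have "X = insert i B - {f}"
    by (intro card_subset_eq) auto
  then show False
    using D f(2) matroid_subset[OF \<I> X(1), of D] by (auto simp: is_circuit_def)
qed

lemma fundamental_circuit_eq:
  fixes \<I> :: "'e::finite set set"
  assumes "matroid \<I>" "B \<in> \<I>" "is_circuit \<I> C" "C \<subseteq> insert i B"
  shows "fundamental_circuit \<I> B i = C"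
  unfolding fundamental_circuit_def
proof (rule the_equality)
  show "is_circuit \<I> C \<and> C \<subseteq> insert i B"
    using assms by simp
  show "D = C" if "is_circuit \<I> D \<and> D \<subseteq> insert i B" for D
    using is_circuit_unique[OF assms(1,2) _ _ assms(3,4)] that by simp
qed

lemma fundamental_circuit:
  fixes \<I> :: "'e::finite set set"
  assumes "matroid \<I>" "is_basis \<I> B" "i \<notin> B"
  shows "is_circuit \<I> (fundamental_circuit \<I> B i)"
    and "fundamental_circuit \<I> B i \<subseteq> insert i B"
proof -
  have "B \<in> \<I>" "insert i B \<notin> \<I>"
    using assms(2,3) by (auto simp: is_basis_def)
  then obtain C where "C \<subseteq> insert i B" "is_circuit \<I> C"
    using dependent_contains_circuit by metis
  then show "is_circuit \<I> (fundamental_circuit \<I> B i)"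
      "fundamental_circuit \<I> B i \<subseteq> insert i B"
    using fundamental_circuit_eq[OF assms(1) \<open>B \<in> \<I>\<close>] by auto
qed

text \<open>\<open>i\<close> lies in the closure iff \<open>insert i A\<close> is dependent, that
  is, contains a circuit; the only circuit within \<open>insert i B\<close> is the fundamental
  one.\<close>

lemma in_closure_iff_fundamental_circuit:
  fixes \<I> :: "'e::finite set set"
  assumes \<I>: "matroid \<I>" and B: "is_basis \<I> B" and i: "i \<notin> B" and A: "A \<subseteq> B"
  shows "i \<in> matroid_closure \<I> A \<longleftrightarrow> fundamental_circuit \<I> B i - {i} \<subseteq> A"
proof -
  have BI: "B \<in> \<I>"
    using B by (simp add: is_basis_def)
  have AI: "A \<in> \<I>"
    using matroid_subset[OF \<I> BI A] .
  have "insert i A \<notin> \<I> \<longleftrightarrow> fundamental_circuit \<I> B i \<subseteq> insert i A"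
  proof
    assume "insert i A \<notin> \<I>"
    then obtain C where C: "C \<subseteq> insert i A" "is_circuit \<I> C"
      using dependent_contains_circuit by metis
    then have "fundamental_circuit \<I> B i = C"
      using A by (intro fundamental_circuit_eq[OF \<I> BI]) auto
    then show "fundamental_circuit \<I> B i \<subseteq> insert i A"
      using C by simp
  next
    assume "fundamental_circuit \<I> B i \<subseteq> insert i A"
    then show "insert i A \<notin> \<I>"
      using fundamental_circuit(1)[OF \<I> B i] matroid_subset[OF \<I>] by (auto simp: is_circuit_def)
  qed
  then show ?thesis
    using A i by (auto simp: in_matroid_closure_iff[OF \<I> AI])
qed

section \<open>Superlevel sets and flags of \<open>basis_phi\<close>\<close>

lemma basis_phi_basis:
  assumes "inj_on b {1..r}" "j \<in> {1..r}"
  shows "basis_phi \<I> r b w $ b j = w j"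
  using assms by (simp add: basis_phi_def)

context
  fixes \<I> :: "'e::finite set set" and r :: nat and b :: "nat \<Rightarrow> 'e"
  assumes \<I>: "matroid \<I>" "loopless \<I>" and b: "ordered_basis \<I> r b"
begin

text \<open>Passing from basis elements to their positions \<open>J\<close> eliminates
  \<open>inv_into\<close>. Looplessness keeps \<open>{i}\<close> from being a circuit, so the
  minimum is over a nonempty set.\<close>

lemma basis_phi_nonbasis:
  fixes w :: "nat \<Rightarrow> real"
  assumes i: "i \<notin> b ` {1..r}"
  defines "J \<equiv> {j\<in>{1..r}. b j \<in> fundamental_circuit \<I> (b ` {1..r}) i}"
  shows "basis_phi \<I> r b w $ i = Min (w ` J)" "J \<noteq> {}"
    and "fundamental_circuit \<I> (b ` {1..r}) i - {i} = b ` J"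
proof -
  have inj: "inj_on b {1..r}" and B: "is_basis \<I> (b ` {1..r})"
    using b by (simp_all add: ordered_basis_def)
  note C = fundamental_circuit[OF \<I>(1) B i]
  show eq: "fundamental_circuit \<I> (b ` {1..r}) i - {i} = b ` J"
    using C(2) i by (auto simp: J_def)
  have "(\<lambda>k. w (inv_into {1..r} b k)) ` b ` J = w ` J"
    unfolding image_image
    by (rule image_cong[OF refl]) (simp only: J_def mem_Collect_eq inv_into_f_f[OF inj])
  then show "basis_phi \<I> r b w $ i = Min (w ` J)"
    using i by (simp add: basis_phi_def Let_def eq del: One_nat_def)
  have "fundamental_circuit \<I> (b ` {1..r}) i \<noteq> {i}" "fundamental_circuit \<I> (b ` {1..r}) i \<noteq> {}"
    using C(1) \<I> by (auto simp: is_circuit_def loopless_def matroid_def)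
  then show "J \<noteq> {}"
    using eq by auto
qed

text \<open>A basis element lies in the closure of a part of the basis only if it belongs to that
  part. For other \<open>i\<close>, the minimum is at least \<open>l\<close> iff all of the
  fundamental circuit except \<open>i\<close> lies in \<open>?A\<close>, which is the closure
  criterion.\<close>

lemma basis_phi_superlevel:
  "{i. l \<le> basis_phi \<I> r b w $ i} = matroid_closure \<I> (b ` {j\<in>{1..r}. l \<le> w j})"
    (is "_ = matroid_closure \<I> ?A")
proof (rule set_eqI)
  fix i
  have inj: "inj_on b {1..r}" and B: "is_basis \<I> (b ` {1..r})"
    using b by (simp_all add: ordered_basis_def)
  have BI: "b ` {1..r} \<in> \<I>"
    using B by (simp add: is_basis_def)
  have AB: "?A \<subseteq> b ` {1..r}"
    by auto
  have AI: "?A \<in> \<I>"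
    using matroid_subset[OF \<I>(1) BI AB] .
  show "i \<in> {i. l \<le> basis_phi \<I> r b w $ i} \<longleftrightarrow> i \<in> matroid_closure \<I> ?A"
  proof (cases "i \<in> b ` {1..r}")
    case True
    then obtain j where j: "j \<in> {1..r}" "i = b j"
      by blast
    have "insert i ?A \<in> \<I>"
      using True AB by (intro matroid_subset[OF \<I>(1) BI]) auto
    then have "i \<in> matroid_closure \<I> ?A \<longleftrightarrow> i \<in> ?A"
      unfolding in_matroid_closure_iff[OF \<I>(1) AI] by blast
    also have "\<dots> \<longleftrightarrow> l \<le> w j"
      using j inj by (auto simp: inj_on_eq_iff)
    finally show ?thesis
      using j basis_phi_basis[OF inj j(1)] by simp
  next
    case False
    define J where "J = {j\<in>{1..r}. b j \<in> fundamental_circuit \<I> (b ` {1..r}) i}"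
    note phi = basis_phi_nonbasis[OF False, folded J_def]
    have "l \<le> basis_phi \<I> r b w $ i \<longleftrightarrow> (\<forall>j\<in>J. l \<le> w j)"
      using phi(1,2) by (simp add: J_def)
    also have "\<dots> \<longleftrightarrow> b ` J \<subseteq> ?A"
      using inj by (auto simp: J_def inj_on_eq_iff)
    also have "\<dots> \<longleftrightarrow> i \<in> matroid_closure \<I> ?A"
      using in_closure_iff_fundamental_circuit[OF \<I>(1) B False AB] phi(3) by simp
    finally show ?thesis
      by simp
  qed
qed

text \<open>The superlevel flags of \<open>w\<close> and of its image run through the same levels,
  so they match entry by entry.\<close>

lemma range_basis_phi: "range (($) (basis_phi \<I> r b w)) = w ` {1..r}"
proof -
  have inj: "inj_on b {1..r}"
    using b by (simp add: ordered_basis_def)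
  have "basis_phi \<I> r b w $ i \<in> w ` {1..r}" for i
  proof (cases "i \<in> b ` {1..r}")
    case True
    then show ?thesis
      using basis_phi_basis[OF inj] by auto
  next
    case False
    define J where "J = {j\<in>{1..r}. b j \<in> fundamental_circuit \<I> (b ` {1..r}) i}"
    note phi = basis_phi_nonbasis[OF False, folded J_def]
    have "Min (w ` J) \<in> w ` J"
      using phi(2) by (intro Min_in) (auto simp: J_def)
    then show ?thesis
      using phi(1) by (auto simp: J_def)
  qed
  moreover have "w j \<in> range (($) (basis_phi \<I> r b w))" if "j \<in> {1..r}" for j
    using basis_phi_basis[OF inj that, of \<I> w] by (metis rangeI)
  ultimately show ?thesis
    by blast
qed

lemma flag_at_basis_phi:
  defines "c \<equiv> (\<lambda>W. matroid_closure \<I> (b ` W))"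
  shows "flag_at \<I> (basis_phi \<I> r b w) = map c (superlevel_flag {1..r} w)"
    and "map c (superlevel_flag {1..r} w) \<in> flags_of_flats \<I>"
proof -
  have B: "b ` {1..r} \<in> \<I>"
    using b by (simp add: ordered_basis_def is_basis_def)
  have "superlevel_flag UNIV (($) (basis_phi \<I> r b w)) = map c (superlevel_flag {1..r} w)"
    by (simp add: superlevel_flag_def range_basis_phi basis_phi_superlevel c_def)
  moreover have "is_flat \<I> {k. basis_phi \<I> r b w $ i \<le> basis_phi \<I> r b w $ k}" for i
    unfolding basis_phi_superlevel
    by (intro is_flat_closure \<I> matroid_subset[OF \<I>(1) B]) auto
  note flag_at_eq_superlevel_flag[OF this]
  ultimately show "flag_at \<I> (basis_phi \<I> r b w) = map c (superlevel_flag {1..r} w)"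
      "map c (superlevel_flag {1..r} w) \<in> flags_of_flats \<I>"
    by simp_all
qed

end

section \<open>The induced flag decoration\<close>

lemma closed_rational_cone: "rational_cone N \<sigma> \<Longrightarrow> closed \<sigma>"
  unfolding rational_cone_def using closed_convex_cone_hull by blast

text \<open>The cones missing \<open>x\<close> have a closed union, being finitely many closed sets;
  a point of \<open>span N\<close> off this union lies in a cone that contains
  \<open>x\<close>.\<close>

lemma complete_fan_nearby_cone:
  assumes \<Delta>: "complete_fan N \<Delta>"
  shows "\<forall>\<^sub>F y in nhds x. y \<in> span N \<longrightarrow> (\<exists>\<delta>\<in>\<Delta>. x \<in> \<delta> \<and> y \<in> \<delta>)"
proof -
  define K where "K = \<Union>{\<delta>\<in>\<Delta>. x \<notin> \<delta>}"
  have "closed K"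
    unfolding K_def using \<Delta> closed_rational_cone
    by (intro closed_Union) (auto simp: complete_fan_def is_fan_def)
  then have "open (- K)" "x \<in> - K"
    by (auto simp: K_def)
  then have "\<forall>\<^sub>F y in nhds x. y \<in> - K"
    by (rule eventually_nhds_in_open)
  then show ?thesis
  proof (rule eventually_mono)
    fix y assume "y \<in> - K"
    then show "y \<in> span N \<longrightarrow> (\<exists>\<delta>\<in>\<Delta>. x \<in> \<delta> \<and> y \<in> \<delta>)"
      using \<Delta> unfolding K_def complete_fan_def by blast
  qed
qed

context
  fixes N :: "'v::euclidean_space set" and \<Delta> :: "'v set set" and \<I> :: "'e::finite set set"
    and r :: nat and \<Phi> :: "'v \<Rightarrow> real ^ 'e" and u :: "nat \<Rightarrow> 'v"
  assumes \<Delta>: "complete_fan N \<Delta>" and \<I>: "matroid \<I>" "loopless \<I>"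
    and u: "global_chern_roots N \<Delta> \<I> r \<Phi> u"
begin

text \<open>One basis serves all points of a cone, so within the cone the flag is a function of the
  sweep.\<close>

lemma cone_flag_at:
  assumes "\<delta> \<in> \<Delta>"
  shows "\<exists>b. ordered_basis \<I> r b \<and> (\<forall>x\<in>\<delta>. flag_at \<I> (\<Phi> x) \<in> flags_of_flats \<I> \<and>
    flag_at \<I> (\<Phi> x) = map (\<lambda>W. matroid_closure \<I> (b ` W)) (sweep r u x))"
proof -
  obtain b where b: "ordered_basis \<I> r b" "\<And>x. x \<in> \<delta> \<Longrightarrow> \<Phi> x = basis_phi \<I> r b (\<lambda>j. u j \<bullet> x)"
    using u assms unfolding global_chern_roots_def by blast
  show ?thesis
    by (rule exI[of _ b])
      (simp add: b flag_at_basis_phi[OF \<I> b(1)] sweep_eq_superlevel_flag del: One_nat_def)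
qed

text \<open>The points with a given sweep form the relative interior of an order cone, which is
  convex and so connected; nearby points among them share a cone of the fan, so the flag is locally
  constant there.\<close>

lemma flag_at_sweep_cong:
  assumes x: "x \<in> span N" and y: "y \<in> span N" and xy: "sweep r u y = sweep r u x"
  shows "flag_at \<I> (\<Phi> y) = flag_at \<I> (\<Phi> x)"
proof -
  define S where "S = {y\<in>span N. sweep r u y = sweep r u x}"
  have "convex S"
    unfolding S_def rel_interior_sweep_order_cone[OF x, symmetric]
    by (intro convex_rel_interior convex_order_cone subspace_span)
  then have "connected S"
    by (rule convex_connected)
  moreover have "\<forall>\<^sub>F z in at w within S. flag_at \<I> (\<Phi> w) = flag_at \<I> (\<Phi> z)" if w: "w \<in> S" for w
    unfolding eventually_at_filter
  proof (rule eventually_mono[OF complete_fan_nearby_cone[OF \<Delta>]], intro impI)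
    fix z assume "z \<in> span N \<longrightarrow> (\<exists>\<delta>\<in>\<Delta>. w \<in> \<delta> \<and> z \<in> \<delta>)" and "z \<in> S"
    then obtain \<delta> where \<delta>: "\<delta> \<in> \<Delta>" "w \<in> \<delta>" "z \<in> \<delta>"
      by (auto simp: S_def)
    obtain b where b: "ordered_basis \<I> r b"
        "\<And>x. x \<in> \<delta> \<Longrightarrow> flag_at \<I> (\<Phi> x) = map (\<lambda>W. matroid_closure \<I> (b ` W)) (sweep r u x)"
        "\<And>x. x \<in> \<delta> \<Longrightarrow> flag_at \<I> (\<Phi> x) \<in> flags_of_flats \<I>"
      using cone_flag_at[OF \<delta>(1)] by blast
    show "flag_at \<I> (\<Phi> w) = flag_at \<I> (\<Phi> z)"
      using b(2)[OF \<delta>(2)] b(2)[OF \<delta>(3)] w \<open>z \<in> S\<close> by (simp add: S_def)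
  qed
  ultimately show ?thesis
    using x y xy by (intro connected_local_const[of S]) (auto simp: S_def)
qed

lemma induced_decoration_sweep:
  assumes "x \<in> span N"
  shows "induced_decoration N \<I> r u \<Phi> (sweep r u x) = flag_at \<I> (\<Phi> x)"
  unfolding induced_decoration_def rel_interior_sweep_cone[OF assms]
proof (rule the_equality)
  show "\<forall>y\<in>{y\<in>span N. sweep r u y = sweep r u x}. flag_at \<I> (\<Phi> y) = flag_at \<I> (\<Phi> x)"
    using flag_at_sweep_cong[OF assms] by blast
  show "\<F> = flag_at \<I> (\<Phi> x)"
    if "\<forall>y\<in>{y\<in>span N. sweep r u y = sweep r u x}. flag_at \<I> (\<Phi> y) = \<F>" for \<F>
    using that[rule_format, of x] assms by simp
qed

text \<open>Refinement means that every weak inequality at \<open>y\<close> also holds at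
  \<open>x\<close>, so mixing in \<open>x\<close> cannot change the weak order as long as
  \<open>y\<close> has positive weight.\<close>

lemma sweep_convex_combination:
  assumes "refined_by (sweep r u x) (sweep r u y)" and t: "0 < t" "t \<le> 1"
  shows "sweep r u ((1 - t) *\<^sub>R x + t *\<^sub>R y) = sweep r u y"
  unfolding sweep_eq_superlevel_flag
proof (rule superlevel_flag_cong)
  fix i j assume ij: "i \<in> {1..r}" "j \<in> {1..r}"
  have coarse: "u l \<bullet> x \<le> u k \<bullet> x" if "u l \<bullet> y \<le> u k \<bullet> y" "k \<in> {1..r}" "l \<in> {1..r}" for k l
  proof -
    have "\<forall>F\<in>set (sweep r u y). l \<in> F \<longrightarrow> k \<in> F"
      using le_iff_superlevel_flag[OF _ that(2,3), of "\<lambda>k. u k \<bullet> y"] that(1)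
      by (simp add: sweep_eq_superlevel_flag)
    then have "\<forall>F\<in>set (sweep r u x). l \<in> F \<longrightarrow> k \<in> F"
      using assms(1) unfolding refined_by_def by blast
    then show ?thesis
      using le_iff_superlevel_flag[OF _ that(2,3), of "\<lambda>k. u k \<bullet> x"]
      by (simp add: sweep_eq_superlevel_flag)
  qed
  have *: "u k \<bullet> ((1 - t) *\<^sub>R x + t *\<^sub>R y) = (1 - t) * (u k \<bullet> x) + t * (u k \<bullet> y)" for k
    by (simp add: inner_add_right)
  show "u j \<bullet> ((1 - t) *\<^sub>R x + t *\<^sub>R y) \<le> u i \<bullet> ((1 - t) *\<^sub>R x + t *\<^sub>R y) \<longleftrightarrow> u j \<bullet> y \<le> u i \<bullet> y"
    unfolding *
  proof
    assume "u j \<bullet> y \<le> u i \<bullet> y"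
    then show "(1 - t) * (u j \<bullet> x) + t * (u j \<bullet> y) \<le> (1 - t) * (u i \<bullet> x) + t * (u i \<bullet> y)"
      using coarse ij t by (intro add_mono mult_left_mono) auto
  next
    assume le: "(1 - t) * (u j \<bullet> x) + t * (u j \<bullet> y) \<le> (1 - t) * (u i \<bullet> x) + t * (u i \<bullet> y)"
    show "u j \<bullet> y \<le> u i \<bullet> y"
    proof (rule ccontr)
      assume "\<not> ?thesis"
      \<comment> \<open>A reversed inequality is strict at \<open>y\<close> and, by
        \<open>coarse\<close>, still weakly reversed at \<open>x\<close>; since \<open>t\<close> is
        positive, the sum contradicts \<open>le\<close>.\<close>
      then have "(1 - t) * (u i \<bullet> x) \<le> (1 - t) * (u j \<bullet> x)" "t * (u i \<bullet> y) < t * (u j \<bullet> y)"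
        using coarse ij t by (auto intro!: mult_left_mono)
      then show False
        using le by linarith
    qed
  qed
qed simp

text \<open>A point \<open>z t\<close> just beyond \<open>x\<close> on the way to \<open>y\<close>
  has the sweep of \<open>y\<close> and shares a cone with \<open>x\<close>. There both flags are
  images of the sweeps under the same closure map, which respects refinement.\<close>

lemma flag_at_sweep_mono:
  assumes x: "x \<in> span N" and y: "y \<in> span N" and xy: "refined_by (sweep r u x) (sweep r u y)"
  shows "refined_by (flag_at \<I> (\<Phi> x)) (flag_at \<I> (\<Phi> y))"
proof -
  define z where "z = (\<lambda>t. (1 - t) *\<^sub>R x + t *\<^sub>R y)"
  have "(z \<longlongrightarrow> (1 - 0) *\<^sub>R x + 0 *\<^sub>R y) (at_right 0)"
    unfolding z_def by (intro tendsto_intros)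
  then have "(z \<longlongrightarrow> x) (at_right 0)"
    by simp
  then have "\<forall>\<^sub>F t in at_right 0. z t \<in> span N \<longrightarrow> (\<exists>\<delta>\<in>\<Delta>. x \<in> \<delta> \<and> z t \<in> \<delta>)"
    by (rule eventually_compose_filterlim[OF complete_fan_nearby_cone[OF \<Delta>]])
  moreover have "\<forall>\<^sub>F t::real in at_right 0. t \<in> {0<..<1}"
    by (rule eventually_at_right_real) simp
  ultimately have ev: "\<forall>\<^sub>F t in at_right 0. t \<in> {0<..<1} \<and>
      (z t \<in> span N \<longrightarrow> (\<exists>\<delta>\<in>\<Delta>. x \<in> \<delta> \<and> z t \<in> \<delta>))"
    by eventually_elim blast
  obtain t where t: "0 < t" "t < 1" "z t \<in> span N \<longrightarrow> (\<exists>\<delta>\<in>\<Delta>. x \<in> \<delta> \<and> z t \<in> \<delta>)"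
    using eventually_happens'[OF trivial_limit_at_right_real ev] by auto
  have zt: "z t \<in> span N"
    unfolding z_def by (intro span_add span_mul x y)
  have sweep: "sweep r u (z t) = sweep r u y"
    unfolding z_def using t(1,2) by (intro sweep_convex_combination[OF xy]) simp_all
  obtain \<delta> where \<delta>: "\<delta> \<in> \<Delta>" "x \<in> \<delta>" "z t \<in> \<delta>"
    using t zt by blast
  obtain b where b: "ordered_basis \<I> r b"
      "\<And>x. x \<in> \<delta> \<Longrightarrow> flag_at \<I> (\<Phi> x) = map (\<lambda>W. matroid_closure \<I> (b ` W)) (sweep r u x)"
      "\<And>x. x \<in> \<delta> \<Longrightarrow> flag_at \<I> (\<Phi> x) \<in> flags_of_flats \<I>"
    using cone_flag_at[OF \<delta>(1)] by blast
  have "refined_by (flag_at \<I> (\<Phi> x)) (flag_at \<I> (\<Phi> (z t)))"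
    using xy sweep by (auto simp: b(2)[OF \<delta>(2)] b(2)[OF \<delta>(3)] refined_by_def)
  then show ?thesis
    using flag_at_sweep_cong[OF y zt sweep] by simp
qed

text \<open>Each flat is the closure of the image of a sweep set under an injective ordering of a
  basis, so its rank is the size of that set.\<close>

lemma flag_at_rank_shape:
  assumes "x \<in> span N"
  shows "flag_at \<I> (\<Phi> x) \<in> flags_of_flats \<I>"
    and "length (flag_at \<I> (\<Phi> x)) = length (sweep r u x)"
    and "i < length (sweep r u x) \<Longrightarrow>
      matroid_rank \<I> (flag_at \<I> (\<Phi> x) ! i) = card (sweep r u x ! i)"
proof -
  obtain \<delta> where \<delta>: "\<delta> \<in> \<Delta>" "x \<in> \<delta>"
    using \<Delta> assms unfolding complete_fan_def by blast
  obtain b where b: "ordered_basis \<I> r b"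
      "\<And>x. x \<in> \<delta> \<Longrightarrow> flag_at \<I> (\<Phi> x) = map (\<lambda>W. matroid_closure \<I> (b ` W)) (sweep r u x)"
      "\<And>x. x \<in> \<delta> \<Longrightarrow> flag_at \<I> (\<Phi> x) \<in> flags_of_flats \<I>"
    using cone_flag_at[OF \<delta>(1)] by blast
  note flag = b(2)[OF \<delta>(2)]
  show "flag_at \<I> (\<Phi> x) \<in> flags_of_flats \<I>"
    by (rule b(3)[OF \<delta>(2)])
  show "length (flag_at \<I> (\<Phi> x)) = length (sweep r u x)"
    by (simp add: flag)
  show "matroid_rank \<I> (flag_at \<I> (\<Phi> x) ! i) = card (sweep r u x ! i)" if i: "i < length (sweep r u x)"
  proof -
    have "sweep r u x ! i \<in> set (sweep r u x)"
      using i by simp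
    then have sub: "sweep r u x ! i \<subseteq> {1..r}"
      by (auto simp: sweep_eq_superlevel_flag set_superlevel_flag)
    have "b ` {1..r} \<in> \<I>"
      using b(1) by (simp add: ordered_basis_def is_basis_def)
    then have "b ` (sweep r u x ! i) \<in> \<I>"
      by (rule matroid_subset[OF \<I>(1)]) (rule image_mono[OF sub])
    moreover have "inj_on b {1..r}"
      using b(1) by (simp add: ordered_basis_def)
    then have "card (b ` (sweep r u x ! i)) = card (sweep r u x ! i)"
      by (rule card_image[OF inj_on_subset[OF _ sub]])
    ultimately show ?thesis
      using i by (simp add: flag matroid_rank_closure[OF \<I>(1)])
  qed
qed

end

theorem lemma4p1:
  fixes N :: "'v::euclidean_space set"
    and \<Delta> :: "'v set set"
    and \<I> :: "'e::finite set set"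
    and r :: nat
    and \<Phi> :: "'v \<Rightarrow> real ^ 'e"
    and u :: "nat \<Rightarrow> 'v"
  assumes "is_lattice N"
    and "complete_fan N \<Delta>"
    and "tropical_bundle N \<Delta> \<I> r \<Phi>"
    and "trivial_chern_class N \<Delta> \<I> r \<Phi>"
    and "global_chern_roots N \<Delta> \<I> r \<Phi> u"
  shows "flag_decoration N \<I> r u (induced_decoration N \<I> r u \<Phi>)"
proof -
  have \<I>: "matroid \<I>" "loopless \<I>"
    using assms(3) by (simp_all add: tropical_bundle_def)
  note facts = assms(2) \<I> assms(5)
  \<comment> \<open>Every sweep is that of some point of \<open>span N\<close>, at which the induced
    decoration is \<open>flag_at\<close>.\<close>
  show ?thesis
    unfolding flag_decoration_def sweeps_def monotone_on_def
    by (auto simp: induced_decoration_sweep[OF facts] flag_at_rank_shape[OF facts]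
        intro: flag_at_sweep_mono[OF facts])
qed

end
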